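(* Let $\Psi\in\mathcal{S}_+^{m\times m}(\mathbb{T})$ and let $G(z)=(zI-A)^{-1}B$ with $A\in\mathbb{C}^{n\times n}$ having all its eigenvalues in the open unit disc, $B\in\mathbb{C}^{n\times m}$ of full column rank, and $(A,B)$ reachable. Suppose that the problem of minimizing $\tilde d_H^2(\Phi,\Psi)$ over $\Phi\in\mathcal{S}_+^{m\times m}(\mathbb{T})$ subject to $\int G\Phi G^*=I$ is feasible, i.e. that $$\mathrm{rank}\begin{pmatrix} I-AA^* & B\\ B^* & 0\end{pmatrix}=2m$$ or, equivalently, $(I-\Pi_B)(I-AA^* )(I-\Pi_B)=0$ where $\Pi_B=B(B^*B)^{-1}B^*$. Then the dual functional $$J_\Psi(\Lambda)=\mathrm{tr}\int (I+G^*\Lambda G)^{-1}\Psi+\mathrm{tr}\,\Lambda$$ has a unique minimum point in $\mathcal{L}_\Gamma^H$.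
   Context: $\mathbb{T}$ is the unit circle; a star denotes conjugate transposition (pointwise on $\mathbb{T}$); integrals are over $[-\pi,\pi]$ with respect to normalized Lebesgue measure $d\theta/2\pi$, functions on $\mathbb{T}$ being evaluated at $e^{i\theta}$. $\mathcal{S}_+^{m\times m}(\mathbb{T})$ is the family of measurable bounded functions $\Phi$ on $\mathbb{T}$ whose values are Hermitian non-negative definite $m\times m$ matrices and for which there is $c_\Phi>0$ with $\Phi(e^{i\theta})-c_\Phi I$ positive definite a.e. Feasible means that there is at least one $\Phi\in\mathcal{S}_+^{m\times m}(\mathbb{T})$ with $\int G\Phi G^*=I$. The distance is $\tilde d_H(\Phi,\Psi)=[\inf\{\|W_\Psi-W_\Phi\|_2^2: W_\Psi,W_\Phi\in L^2_{m\times m},\ W_\Psi W_\Psi^*=\Psi,\ W_\Phi W_\Phi^*=\Phi\}]^{1/2}$, where $L^2_{m\times m}$ is the space of measurable $F:\mathbb{T}\to\mathbb{C}^{m\times m}$ with $\|F\|_2^2=\int\mathrm{tr}\,FF^*<\infty$. $\Gamma$ is the linear operator $\Gamma(\Phi)=\int G\Phi G^*$ defined on the set $\mathcal{C}_H(\mathbb{T})$ of continuous functions on $\mathbb{T}$ with Hermitian $m\times m$ values; $\mathrm{Range}(\Gamma)$ is its range. $\mathcal{L}^H:=\{\Lambda\in\mathbb{C}^{n\times n}:\Lambda=\Lambda^*,\ I+G^*\Lambda G>0\ \text{at every } e^{i\theta}\in\mathbb{T}\}$ and $\mathcal{L}_\Gamma^H:=\mathcal{L}^H\cap\mathrm{Range}(\Gamma)$.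 *)

theory Defs
  imports "HOL-Analysis.Analysis"
begin

definition ctrans :: "complex^'a^'b \<Rightarrow> complex^'b^'a"
  where "ctrans M = (\<chi> i j. cnj (M $ j $ i))"

definition herm :: "complex^'a^'a \<Rightarrow> bool"
  where "herm M \<longleftrightarrow> ctrans M = M"

text \<open>The inner product of \<^typ>\<open>complex^'a\<close> is the real one, so \<^term>\<open>v \<bullet> (M *v v)\<close> is
  the real part of $v^* M v$, and equal to $v^* M v$ when $M$ is Hermitian.\<close>

definition nonneg_def :: "complex^'a^'a \<Rightarrow> bool"
  where "nonneg_def M \<longleftrightarrow> herm M \<and> (\<forall>v. 0 \<le> v \<bullet> (M *v v))"

definition pos_def :: "complex^'a^'a \<Rightarrow> bool"
  where "pos_def M \<longleftrightarrow> herm M \<and> (\<forall>v. v \<noteq> 0 \<longrightarrow> 0 < v \<bullet> (M *v v))"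

definition eigenvalue :: "complex^'a^'a \<Rightarrow> complex \<Rightarrow> bool"
  where "eigenvalue M l \<longleftrightarrow> (\<exists>v. v \<noteq> 0 \<and> M *v v = l *s v)"

text \<open>State at time \<open>k\<close> of the system $x_{k+1} = A x_k + B u_k$ started at $x_0 = 0$.\<close>

primrec state :: "complex^'n^'n \<Rightarrow> complex^'m^'n \<Rightarrow> (nat \<Rightarrow> complex^'m) \<Rightarrow> nat \<Rightarrow> complex^'n" where
  "state A B u 0 = 0"
| "state A B u (Suc k) = A *v state A B u k + B *v u k"

definition reachable :: "complex^'n^'n \<Rightarrow> complex^'m^'n \<Rightarrow> bool"
  where "reachable A B \<longleftrightarrow> (\<forall>x. \<exists>u k. state A B u k = x)"

text \<open>Functions on the unit circle are functions on \<^typ>\<open>complex\<close>; only their values on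
  \<^term>\<open>sphere (0::complex) 1\<close> are ever used.\<close>

definition circle_integral :: "(complex \<Rightarrow> 'b::euclidean_space) \<Rightarrow> 'b"
  where "circle_integral F = (LINT \<theta>|lebesgue_on {-pi..pi}. F (cis \<theta>)) /\<^sub>R (2 * pi)"

definition S_plus :: "(complex \<Rightarrow> complex^'m^'m) set"
  where "S_plus = {\<Phi>.
    (\<lambda>\<theta>. \<Phi> (cis \<theta>)) \<in> borel_measurable (lebesgue_on {-pi..pi}) \<and>
    bounded (\<Phi> ` sphere 0 1) \<and>
    (\<forall>z\<in>sphere 0 1. nonneg_def (\<Phi> z)) \<and>
    (\<exists>c::real. 0 < c \<and>
      (AE \<theta> in lebesgue_on {-pi..pi}. pos_def (\<Phi> (cis \<theta>) - mat (of_real c))))}"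

definition transfer :: "complex^'n^'n \<Rightarrow> complex^'m^'n \<Rightarrow> complex \<Rightarrow> complex^'m^'n"
  where "transfer A B z = matrix_inv (mat z - A) ** B"

definition Gam :: "complex^'n^'n \<Rightarrow> complex^'m^'n \<Rightarrow> (complex \<Rightarrow> complex^'m^'m) \<Rightarrow> complex^'n^'n"
  where "Gam A B \<Phi> =
    circle_integral (\<lambda>z. transfer A B z ** \<Phi> z ** ctrans (transfer A B z))"

text \<open>The admissible set of the minimization problem is nonempty; its objective
  $\tilde d_H^2(\Phi, \Psi)$ plays no role here.\<close>

definition feasible :: "complex^'n^'n \<Rightarrow> complex^'m^'n \<Rightarrow> bool"
  where "feasible A B \<longleftrightarrow> (\<exists>\<Phi>\<in>S_plus. Gam A B \<Phi> = mat 1)"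

definition block_matrix :: "complex^'n^'n \<Rightarrow> complex^'m^'n \<Rightarrow> complex^('n + 'm)^('n + 'm)"
  where "block_matrix A B = (\<chi> i j. case i of
      Inl k \<Rightarrow> (case j of Inl l \<Rightarrow> (mat 1 - A ** ctrans A) $ k $ l | Inr l \<Rightarrow> B $ k $ l)
    | Inr k \<Rightarrow> (case j of Inl l \<Rightarrow> ctrans B $ k $ l | Inr l \<Rightarrow> 0))"

definition Pi_proj :: "complex^'m^'n \<Rightarrow> complex^'n^'n"
  where "Pi_proj B = B ** matrix_inv (ctrans B ** B) ** ctrans B"

definition C_herm :: "(complex \<Rightarrow> complex^'m^'m) set"
  where "C_herm = {\<Phi>. continuous_on (sphere 0 1) \<Phi> \<and> (\<forall>z\<in>sphere 0 1. herm (\<Phi> z))}"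

definition L_H :: "complex^'n^'n \<Rightarrow> complex^'m^'n \<Rightarrow> (complex^'n^'n) set"
  where "L_H A B = {\<Lambda>. herm \<Lambda> \<and>
    (\<forall>z\<in>sphere 0 1. pos_def (mat 1 + ctrans (transfer A B z) ** \<Lambda> ** transfer A B z))}"

definition L_Gam :: "complex^'n^'n \<Rightarrow> complex^'m^'n \<Rightarrow> (complex^'n^'n) set"
  where "L_Gam A B = L_H A B \<inter> Gam A B ` C_herm"

text \<open>For $\Lambda$ in \<^term>\<open>L_H A B\<close> both traces are real (the first is the integral of traces of
  products of two Hermitian matrices), so taking the real part only changes the type.\<close>

definition J_dual ::
  "complex^'n^'n \<Rightarrow> complex^'m^'n \<Rightarrow> (complex \<Rightarrow> complex^'m^'m) \<Rightarrow> complex^'n^'n \<Rightarrow> real"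
  where "J_dual A B \<Psi> \<Lambda> = Re (
    trace (circle_integral (\<lambda>z.
      matrix_inv (mat 1 + ctrans (transfer A B z) ** \<Lambda> ** transfer A B z) ** \<Psi> z))
    + trace \<Lambda>)"

end

theory Submission
  imports Defs "HOL-Complex_Analysis.Cauchy_Integral_Formula"
begin

text \<open>
  \<^bold>\<open>Feasibility.\<close> On the circle $AG = zG - B$. Multiplying by the orthogonal projection
  $C = I - \Pi_B$ kills \<open>B\<close>, so $CAG\,\Phi\,(CAG)^* = CG\,\Phi\,(CG)^*$, and a state covariance
  $\int G\Phi G^* = I$ forces $CAA^*C = C$, which is the projection condition
  (\<open>feasible_imp_condition\<close>). Conversely the condition says that \<open>F = CA\<close> satisfies
  $FF^* = I - \Pi_B$. With $U = (I - \bar z F)^{-1}$ a direct computation gives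
  $U\,\Pi_B\,U^* = U + U^* - I$ on the circle, and the mean of the right-hand side is \<open>I\<close> by the mean
  value property of analytic functions. Since \<open>F\<close> arises from \<open>A\<close> by a state feedback, the left-hand side
  has the form $G\Phi G^*$ with \<open>\<Phi>\<close> continuous and positive definite (\<open>condition_imp_feasible\<close>).
  The rank condition is the projection condition read off the row space of the block matrix
  (\<open>rank_block_matrix_iff\<close>).

  \<^bold>\<open>Existence.\<close> Write $Q_\Lambda = I + G^*\Lambda G$. A feasible \<open>\<Phi>\<close> turns the linear term into an
  integral, $\mathrm{tr}\,\Lambda = \int \mathrm{tr}\,\Phi(Q_\Lambda - I)$, so that a bound on the functional bounds both
  $\int\mathrm{tr}\,Q_\Lambda$ and $\int\mathrm{tr}\,Q_\Lambda^{-1}$ (\<open>sublevel_integral_bounds\<close>).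
  The first bounds \<open>\<Lambda>\<close>, because \<open>\<Lambda>\<close> lies in the range of $\Gamma$, whose adjoint is
  $\Lambda \mapsto G^*\Lambda G$ (\<open>bounded_of_integral_bound\<close>).
  The second keeps $Q_\Lambda$ uniformly away from singular matrices: a form that is small
  at one point of the circle grows at most linearly away from it, so its reciprocal has a large integral
  (\<open>boundary_barrier\<close>). Hence the minimum may be sought on a compact set, where the
  functional is continuous.

  \<^bold>\<open>Uniqueness.\<close> The functional is strictly convex, because $Q \mapsto \mathrm{tr}\,Q^{-1}\Psi$ is
  (\<open>trace_inverse_midpoint\<close>) and $\Lambda \mapsto G^*\Lambda G$ is injective on the range of $\Gamma$
  (\<open>minimizer_unique\<close>).
\<close>

section \<open>Hermitian matrices and traces\<close>

lemma ctrans_nth [simp]: "ctrans M $ i $ j = cnj (M $ j $ i)"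
  by (simp add: ctrans_def)

lemma ctrans_ctrans [simp]: "ctrans (ctrans M) = M"
  by (simp add: vec_eq_iff)

lemma ctrans_mult: "ctrans (M ** N) = ctrans N ** ctrans M"
  by (simp add: vec_eq_iff matrix_matrix_mult_def mult.commute)

lemma ctrans_add: "ctrans (M + N) = ctrans M + ctrans N"
  by (simp add: vec_eq_iff)

lemma ctrans_diff: "ctrans (M - N) = ctrans M - ctrans N"
  by (simp add: vec_eq_iff)

lemma ctrans_scaleR: "ctrans (c *\<^sub>R M) = c *\<^sub>R ctrans M"
  by (simp add: vec_eq_iff)

lemma ctrans_mat [simp]: "ctrans (mat c) = mat (cnj c)"
  by (simp add: vec_eq_iff mat_def)

lemma bounded_linear_ctrans: "bounded_linear (ctrans :: complex^'a^'b \<Rightarrow> complex^'b^'a)"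
  by (intro linear_conv_bounded_linear[THEN iffD1] linearI) (simp_all add: ctrans_add ctrans_scaleR)

lemma bounded_bilinear_matrix_mult:
  "bounded_bilinear ((**) :: complex^'b^'c \<Rightarrow> complex^'a^'b \<Rightarrow> complex^'a^'c)"
  by (intro bilinear_conv_bounded_bilinear[THEN iffD1])
     (simp_all add: bilinear_def linear_iff vec_eq_iff matrix_matrix_mult_def algebra_simps
        sum.distrib scaleR_sum_right)

interpretation mm: bounded_bilinear "(**) :: complex^'b^'c \<Rightarrow> complex^'a^'b \<Rightarrow> complex^'a^'c"
  by (rule bounded_bilinear_matrix_mult)

lemma bounded_linear_trace: "bounded_linear (trace :: complex^'a^'a \<Rightarrow> complex)"
  by (intro linear_conv_bounded_linear[THEN iffD1] linearI)
     (simp_all add: trace_def sum.distrib scaleR_sum_right)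

lemma bounded_linear_Re_trace_mult:
  "bounded_linear (\<lambda>X. Re (trace (M ** X)))" for M :: "complex^'b^'a"
  by (intro bounded_linear_compose[OF bounded_linear_Re]
      bounded_linear_compose[OF bounded_linear_trace] mm.bounded_linear_right)

lemma inner_complex_vec: "v \<bullet> w = Re (\<Sum>i\<in>UNIV. cnj (v $ i) * w $ i)" for v w :: "complex^'a"
  by (simp add: inner_vec_def inner_complex_def)

lemma inner_ctrans: "(M *v x) \<bullet> y = x \<bullet> (ctrans M *v y)" for M :: "complex^'a^'b"
proof -
  have "(\<Sum>i\<in>UNIV. cnj (\<Sum>j\<in>UNIV. M $ i $ j * x $ j) * y $ i)
      = (\<Sum>j\<in>UNIV. \<Sum>i\<in>UNIV. cnj (x $ j) * (cnj (M $ i $ j) * y $ i))"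
    by (subst sum.swap) (simp add: sum_distrib_left sum_distrib_right mult_ac)
  also have "\<dots> = (\<Sum>j\<in>UNIV. cnj (x $ j) * (\<Sum>i\<in>UNIV. cnj (M $ i $ j) * y $ i))"
    by (simp add: sum_distrib_left)
  finally show ?thesis
    by (simp add: inner_complex_vec matrix_vector_mult_def)
qed

lemma inner_congruence:
  "v \<bullet> ((ctrans E ** P ** E) *v v) = (E *v v) \<bullet> (P *v (E *v v))" for P :: "complex^'b^'b"
  by (simp add: inner_ctrans matrix_vector_mul_assoc matrix_mul_assoc)

lemma herm_iff_nth: "herm M \<longleftrightarrow> (\<forall>i j. cnj (M $ i $ j) = M $ j $ i)"
  by (auto simp: herm_def vec_eq_iff)

lemma inner_herm_trace: "herm M \<Longrightarrow> M \<bullet> N = Re (trace (M ** N))" for M N :: "complex^'a^'a"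
proof -
  assume M: "herm M"
  have h: "M $ i $ j \<bullet> N $ i $ j = Re (M $ j $ i * N $ i $ j)" for i j
  proof -
    have "M $ j $ i = cnj (M $ i $ j)" using M by (simp add: herm_iff_nth)
    then show ?thesis by (simp add: inner_complex_def)
  qed
  have "M \<bullet> N = Re (\<Sum>i\<in>UNIV. \<Sum>j\<in>UNIV. M $ j $ i * N $ i $ j)"
    by (simp add: inner_vec_def h)
  also have "\<dots> = Re (trace (M ** N))"
    by (subst sum.swap) (simp add: trace_def matrix_matrix_mult_def)
  finally show ?thesis .
qed

lemma matrix_inv_works:
  assumes "invertible M"
  shows "M ** matrix_inv M = mat 1" "matrix_inv M ** M = mat 1"
  using someI_ex[OF assms[unfolded invertible_def]] unfolding matrix_inv_def by auto

lemma matrix_inv_unique: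
  fixes M :: "complex^'a^'a"
  assumes "M ** X = mat 1"
  shows "matrix_inv M = X"
proof -
  have "invertible M" using assms invertible_right_inverse by blast
  then have "matrix_inv M ** M = mat 1" by (rule matrix_inv_works)
  then show ?thesis
    by (metis assms matrix_mul_assoc matrix_mul_lid matrix_mul_rid)
qed

lemma invertible_ker: "invertible M \<longleftrightarrow> (\<forall>x. M *v x = 0 \<longrightarrow> x = 0)" for M :: "complex^'a^'a"
  by (simp add: invertible_left_inverse matrix_left_invertible_ker)

lemma matrix_vector_mult_scaleR_complex: "M *v (c *\<^sub>R x) = c *\<^sub>R (M *v x)" for M :: "complex^'a^'b"
  by (rule linear_cmul[OF matrix_vector_mul_linear])

lemma matrix_vector_mult_axis: "M *v axis j c = (\<chi> i. M $ i $ j * c)" for M :: "complex^'a^'b"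
  by (simp add: vec_eq_iff matrix_vector_mult_def axis_def if_distrib cong: if_cong)

lemma inner_axis_axis_form: "axis i c \<bullet> (M *v axis j d) = Re (cnj c * M $ i $ j * d)" for M :: "complex^'a^'b"
  by (simp add: matrix_vector_mult_axis inner_axis' inner_complex_def algebra_simps)

lemma nonneg_def_diag:
  fixes P :: "complex^'a^'a"
  assumes "nonneg_def P"
  shows "0 \<le> Re (P $ i $ i)" "Im (P $ i $ i) = 0"
proof -
  show "0 \<le> Re (P $ i $ i)"
    using assms inner_axis_axis_form[of i 1 P i 1] by (auto simp: nonneg_def_def dest: spec[of _ "axis i 1"])
  have "cnj (P $ i $ i) = P $ i $ i"
    using assms by (auto simp: nonneg_def_def herm_iff_nth)
  then show "Im (P $ i $ i) = 0"
    by (simp add: complex_eq_iff)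
qed

lemma Re_trace_nonneg: "nonneg_def P \<Longrightarrow> 0 \<le> Re (trace P)"
  by (simp add: trace_def nonneg_def_diag sum_nonneg)

text \<open>Test positivity on $e_i + c\,e_j$, where the unit \<open>c\<close> rotates the entry to minus its modulus.\<close>

lemma nonneg_def_entry_le:
  assumes P: "nonneg_def P"
  shows "cmod (P $ i $ j) \<le> (Re (P $ i $ i) + Re (P $ j $ j)) / 2"
proof (cases "P $ i $ j = 0")
  case True
  then show ?thesis using nonneg_def_diag[OF P] by simp
next
  case False
  define p where "p = P $ i $ j"
  define c where "c = - cnj p / cmod p"
  have p0: "p \<noteq> 0" using False p_def by simp
  have cp: "c * p = - complex_of_real (cmod p)"
    using p0 complex_norm_square[of p] by (simp add: c_def field_simps power2_eq_square)
  have cc: "cnj c * c = 1"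
    using p0 complex_norm_square[of p] by (simp add: c_def field_simps power2_eq_square)
  have ji: "P $ j $ i = cnj p"
    using P by (auto simp: nonneg_def_def herm_iff_nth p_def)
  have "0 \<le> (axis i 1 + axis j c) \<bullet> (P *v (axis i 1 + axis j c))"
    using P by (auto simp: nonneg_def_def)
  also have "\<dots> = Re (P $ i $ i) + Re (p * c) + Re (cnj c * cnj p) + Re (cnj c * P $ j $ j * c)"
    by (simp only: matrix_vector_right_distrib inner_add_left inner_add_right inner_axis_axis_form)
       (simp add: ji p_def)
  also have "cnj c * P $ j $ j * c = P $ j $ j"
    using cc by (simp add: mult_ac flip: mult.assoc)
  also have "cnj c * cnj p = - complex_of_real (cmod p)"
    using cp by (metis complex_cnj_complex_of_real complex_cnj_minus complex_cnj_mult)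
  also have "p * c = - complex_of_real (cmod p)"
    using cp by (simp add: mult.commute)
  finally show ?thesis by (simp add: p_def)
qed

text \<open>For non-negative matrices the trace dominates the norm, so bounds on integrals of traces become
  bounds on the matrices themselves.\<close>

lemma nonneg_def_norm_le:
  fixes P :: "complex^'a^'a"
  assumes P: "nonneg_def P"
  shows "norm P \<le> (CARD('a))\<^sup>2 * Re (trace P)"
proof -
  have d: "Re (P $ i $ i) \<le> Re (trace P)" for i
    unfolding trace_def Re_sum by (rule member_le_sum) (auto simp: nonneg_def_diag[OF P])
  have e: "cmod (P $ i $ j) \<le> Re (trace P)" for i j
  proof -
    have "(Re (P $ i $ i) + Re (P $ j $ j)) / 2 \<le> Re (trace P)"
      using add_mono[OF d[of i] d[of j]] by simp
    then show ?thesis using nonneg_def_entry_le[OF P, of i j] by (rule order_trans[rotated])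
  qed
  have "norm P \<le> (\<Sum>i\<in>UNIV. norm (P $ i))"
    unfolding norm_vec_def by (rule L2_set_le_sum) auto
  also have "\<dots> \<le> (\<Sum>i\<in>UNIV. \<Sum>j\<in>UNIV. cmod (P $ i $ j))"
    unfolding norm_vec_def by (intro sum_mono L2_set_le_sum) auto
  also have "\<dots> \<le> (\<Sum>i\<in>(UNIV::'a set). \<Sum>j\<in>(UNIV::'a set). Re (trace P))"
    by (intro sum_mono e)
  also have "\<dots> = (CARD('a))\<^sup>2 * Re (trace P)"
    by (simp add: power2_eq_square)
  finally show ?thesis .
qed

text \<open>Cholesky elimination: subtracting from \<open>P\<close> the rank one matrix built from its \<open>i\<close>-th column
  kills the \<open>i\<close>-th diagonal entry, keeps \<open>P\<close> non-negative, and contributes a value of the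
  quadratic form of \<open>Q\<close> to the trace. The induction is on the number of nonzero diagonal entries.\<close>

lemma trace_mult_nonneg:
  fixes P Q :: "complex^'a^'a"
  assumes "nonneg_def P" "nonneg_def Q"
  shows "0 \<le> Re (trace (P ** Q))"
  using assms(1)
proof (induction "card {i. P $ i $ i \<noteq> 0}" arbitrary: P rule: less_induct)
  case less
  note P = \<open>nonneg_def P\<close>
  show ?case
  proof (cases "\<forall>i. P $ i $ i = 0")
    case True
    have "P $ i $ j = 0" for i j
      using nonneg_def_entry_le[OF P, of i j] True by simp
    then have "P = 0" by (simp add: vec_eq_iff)
    then show ?thesis by (simp add: trace_def mm.zero_left)
  next
    case False
    then obtain i where i: "P $ i $ i \<noteq> 0" by blast
    define p where "p = Re (P $ i $ i)"
    have Pii: "P $ i $ i = of_real p"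
      using nonneg_def_diag[OF P] by (simp add: complex_eq_iff p_def)
    have p: "p > 0"
    proof -
      have "p \<noteq> 0" using i Pii by simp
      then show ?thesis using nonneg_def_diag(1)[OF P, of i] by (simp add: p_def)
    qed
    have cP: "cnj (P $ a $ b) = P $ b $ a" for a b
      using P by (auto simp: nonneg_def_def herm_iff_nth)
    define P' :: "complex^'a^'a" where "P' = (\<chi> a b. P $ a $ b - P $ a $ i * P $ i $ b / p)"
    \<comment> \<open>\<open>E\<close> is the elementary column operation of the elimination: $P' = E^*PE$ inherits positivity.\<close>
    define E :: "complex^'a^'a" where "E = mat 1 - (\<chi> a b. if a = i then P $ i $ b / p else 0)"
    have PE: "P ** E = P'"
      unfolding E_def mm.diff_right matrix_mul_rid
      by (simp add: P'_def vec_eq_iff matrix_matrix_mult_def if_distrib[of "\<lambda>x. _ * x"] cong: if_cong)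
    have "ctrans E ** P' = P'"
      unfolding E_def ctrans_diff mm.diff_left ctrans_mat complex_cnj_one matrix_mul_lid
      using p by (simp add: P'_def vec_eq_iff matrix_matrix_mult_def cP if_distrib[of cnj]
        if_distrib[of "\<lambda>x. x * _"] Pii cong: if_cong)
    then have P'E: "P' = ctrans E ** P ** E"
      using PE by (simp flip: matrix_mul_assoc)
    have P': "nonneg_def P'"
      unfolding nonneg_def_def
    proof
      show "herm P'" using cP by (simp add: herm_iff_nth P'_def mult.commute)
      show "\<forall>v. 0 \<le> v \<bullet> (P' *v v)"
        using P by (simp add: P'E inner_congruence nonneg_def_def)
    qed
    have "{a. P' $ a $ a \<noteq> 0} \<subset> {a. P $ a $ a \<noteq> 0}"
    proof -
      have "P' $ a $ a = 0" if "P $ a $ a = 0" for a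
      proof -
        have "P $ a $ i * P $ i $ a / p = of_real ((cmod (P $ a $ i))\<^sup>2 / p)"
          using complex_norm_square[of "P $ a $ i"] cP[of a i] by simp
        then have "P' $ a $ a = - of_real ((cmod (P $ a $ i))\<^sup>2 / p)"
          using that by (simp add: P'_def)
        moreover have "0 \<le> (cmod (P $ a $ i))\<^sup>2 / p" using p by simp
        ultimately show ?thesis using nonneg_def_diag(1)[OF P', of a] by simp
      qed
      moreover have "P' $ i $ i = 0" using p by (simp add: P'_def Pii)
      ultimately show ?thesis using i by blast
    qed
    then have "card {a. P' $ a $ a \<noteq> 0} < card {a. P $ a $ a \<noteq> 0}"
      by (rule psubset_card_mono[rotated]) simp
    then have IH: "0 \<le> Re (trace (P' ** Q))" using less.hyps P' by blast
    define w where "w = (\<chi> a. P $ a $ i)"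
    have "trace (P ** Q) = trace (P' ** Q)
        + (\<Sum>a\<in>UNIV. \<Sum>b\<in>UNIV. P $ a $ i * P $ i $ b * Q $ b $ a) / p"
    proof -
      have "P $ a $ b * Q $ b $ a = P' $ a $ b * Q $ b $ a + P $ a $ i * P $ i $ b * Q $ b $ a / p" for a b
        by (simp add: P'_def left_diff_distrib)
      then have "(\<Sum>a\<in>UNIV. \<Sum>b\<in>UNIV. P $ a $ b * Q $ b $ a)
          = (\<Sum>a\<in>UNIV. \<Sum>b\<in>UNIV. P' $ a $ b * Q $ b $ a + P $ a $ i * P $ i $ b * Q $ b $ a / p)"
        by (intro sum.cong refl)
      then show ?thesis
        by (simp only: trace_def matrix_matrix_mult_def vec_lambda_beta sum.distrib sum_divide_distrib)
    qed
    also have "(\<Sum>a\<in>UNIV. \<Sum>b\<in>UNIV. P $ a $ i * P $ i $ b * Q $ b $ a)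
        = (\<Sum>b\<in>UNIV. cnj (w $ b) * (Q *v w) $ b)"
      by (subst sum.swap)
         (simp add: w_def cP matrix_vector_mult_def sum_distrib_left mult_ac)
    finally have "Re (trace (P ** Q)) = Re (trace (P' ** Q)) + (w \<bullet> (Q *v w)) / p"
      by (simp add: inner_complex_vec Re_divide_of_real)
    moreover have "0 \<le> w \<bullet> (Q *v w)" using assms(2) by (simp add: nonneg_def_def)
    ultimately show ?thesis using IH p by simp
  qed
qed

lemma pos_def_imp_nonneg_def: "pos_def M \<Longrightarrow> nonneg_def M"
  unfolding pos_def_def nonneg_def_def by (metis inner_zero_left less_eq_real_def)

lemma pos_def_imp_invertible: "pos_def M \<Longrightarrow> invertible M"
  unfolding invertible_ker pos_def_def by (metis inner_zero_right less_irrefl)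

lemma pos_def_mat_1 [simp]: "pos_def (mat 1)"
  by (auto simp: pos_def_def herm_def)

lemma pos_def_matrix_inv:
  fixes Q :: "complex^'a^'a"
  assumes Q: "pos_def Q"
  shows "pos_def (matrix_inv Q)"
proof -
  let ?Y = "matrix_inv Q"
  have inv: "Q ** ?Y = mat 1" "?Y ** Q = mat 1"
    using matrix_inv_works pos_def_imp_invertible[OF Q] by auto
  have hQ: "ctrans Q = Q" using Q by (simp add: pos_def_def herm_def)
  have "ctrans (?Y ** Q) = mat 1" by (simp add: inv)
  then have "Q ** ctrans ?Y = mat 1" by (simp add: ctrans_mult hQ)
  then have h: "ctrans ?Y = ?Y" by (metis matrix_inv_unique)
  have "0 < v \<bullet> (?Y *v v)" if v: "v \<noteq> 0" for v
  proof -
    have QY: "Q *v (?Y *v v) = v" by (simp add: matrix_vector_mul_assoc inv)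
    then have "?Y *v v \<noteq> 0" using v by auto
    then have "0 < (?Y *v v) \<bullet> (Q *v (?Y *v v))" using Q by (auto simp: pos_def_def)
    then show ?thesis by (simp add: QY inner_commute)
  qed
  then show ?thesis using h by (auto simp: pos_def_def herm_def)
qed

text \<open>The Cauchy-Schwarz inequality for the inner product of \<open>Q\<close>, applied to \<open>u\<close> and \<open>Q\<^sup>-\<^sup>1 u\<close>.\<close>

lemma inverse_quadratic_form_ge:
  fixes Q :: "complex^'a^'a"
  assumes Q: "pos_def Q" and u: "norm u = 1"
  shows "1 / (u \<bullet> (Q *v u)) \<le> u \<bullet> (matrix_inv Q *v u)"
proof -
  let ?Y = "matrix_inv Q"
  define q p where "q = u \<bullet> (Q *v u)" and "p = u \<bullet> (?Y *v u)"
  have "u \<noteq> 0" using u by auto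
  then have q: "0 < q" using Q by (auto simp: pos_def_def q_def)
  have hQ: "ctrans Q = Q" using Q by (simp add: pos_def_def herm_def)
  have QY: "Q *v (?Y *v u) = u"
    by (simp add: matrix_vector_mul_assoc matrix_inv_works pos_def_imp_invertible[OF Q])
  have sym: "(?Y *v u) \<bullet> (Q *v u) = u \<bullet> u"
    using inner_ctrans[of Q "?Y *v u" u] by (simp add: hQ QY)
  have "0 \<le> (u - q *\<^sub>R (?Y *v u)) \<bullet> (Q *v (u - q *\<^sub>R (?Y *v u)))"
    using pos_def_imp_nonneg_def[OF Q] by (auto simp: nonneg_def_def)
  also have "\<dots> = q - 2 * q * (u \<bullet> u) + q\<^sup>2 * p"
    by (simp add: matrix_vector_mult_diff_distrib matrix_vector_mult_scaleR_complex QY inner_diff_left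
        inner_diff_right sym sym[unfolded inner_commute[of "?Y *v u"]] q_def[symmetric] p_def inner_commute power2_eq_square algebra_simps)
  also have "u \<bullet> u = 1" using u by (simp add: dot_square_norm)
  finally have "q * 1 \<le> q * (q * p)" by (simp add: power2_eq_square algebra_simps)
  then have "1 \<le> q * p" using q by (simp only: mult_le_cancel_left_pos)
  then show ?thesis
    using q by (simp add: q_def[symmetric] p_def[symmetric] field_simps)
qed

section \<open>Integration over the unit circle\<close>

abbreviation circ :: "real measure" where "circ \<equiv> lebesgue_on {-pi..pi}"

lemma finite_measure_circ: "finite_measure circ"
  by (rule finite_measure_lebesgue_on) simp

lemma integrable_circ_bounded:
  fixes f :: "real \<Rightarrow> 'b::euclidean_space"
  assumes "f \<in> borel_measurable circ" "\<And>\<theta>. norm (f \<theta>) \<le> C"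
  shows "integrable circ f"
  using finite_measure.integrable_const_bound[OF finite_measure_circ _ assms(1), of C] assms(2)
  by simp

lemma cis_in_sphere [simp]: "cis \<theta> \<in> sphere 0 1"
  by simp

lemma sphere_obtain_angle:
  assumes "z \<in> sphere (0::complex) 1"
  obtains \<theta> where "\<theta> \<in> {-pi..pi}" "z = cis \<theta>"
proof
  show "Arg z \<in> {-pi..pi}" using Arg_bounded[of z] by auto
  have "norm z = 1" using assms by simp
  then show "z = cis (Arg z)"
    using cis_Arg[of z] by (cases "z = 0") (auto simp: sgn_div_norm)
qed

lemma continuous_on_cis_compose:
  "continuous_on (sphere 0 1) F \<Longrightarrow> continuous_on S (\<lambda>\<theta>. F (cis \<theta>))"
  by (rule continuous_on_compose2[of "sphere 0 1" F]) (auto intro!: continuous_intros)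

lemma measurable_circ_continuous:
  fixes F :: "complex \<Rightarrow> 'b::euclidean_space"
  assumes "continuous_on (sphere 0 1) F"
  shows "(\<lambda>\<theta>. F (cis \<theta>)) \<in> borel_measurable circ"
  by (rule continuous_imp_measurable_on_sets_lebesgue[OF continuous_on_cis_compose[OF assms]]) simp

lemma continuous_sphere_bounded:
  fixes F :: "complex \<Rightarrow> 'b::euclidean_space"
  assumes "continuous_on (sphere 0 1) F"
  obtains C where "0 < C" "\<And>z. z \<in> sphere 0 1 \<Longrightarrow> norm (F z) \<le> C"
  using compact_imp_bounded[OF compact_continuous_image[OF assms compact_sphere]]
  by (auto simp: bounded_pos)

lemma integrable_circ_continuous:
  fixes F :: "complex \<Rightarrow> 'b::euclidean_space"
  assumes "continuous_on (sphere 0 1) F"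
  shows "integrable circ (\<lambda>\<theta>. F (cis \<theta>))"
proof -
  obtain C where "\<And>z. z \<in> sphere 0 1 \<Longrightarrow> norm (F z) \<le> C"
    using continuous_sphere_bounded[OF assms] by metis
  then show ?thesis
    by (intro integrable_circ_bounded[where C = C, OF measurable_circ_continuous[OF assms]]) simp
qed

abbreviation integrable_circle :: "(complex \<Rightarrow> 'b::euclidean_space) \<Rightarrow> bool"
  where "integrable_circle F \<equiv> integrable circ (\<lambda>\<theta>. F (cis \<theta>))"

lemma circle_integral_bounded_linear:
  fixes T :: "'a::euclidean_space \<Rightarrow> 'b::euclidean_space"
  assumes "bounded_linear T" "integrable_circle F"
  shows "T (circle_integral F) = circle_integral (\<lambda>z. T (F z))"
  using integral_bounded_linear[OF assms] linear_cmul[OF bounded_linear.linear[OF assms(1)]]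
  by (simp add: circle_integral_def)

lemma circle_integral_add:
  assumes "integrable_circle F" "integrable_circle H"
  shows "circle_integral (\<lambda>z. F z + H z) = circle_integral F + circle_integral H"
  using assms by (simp add: circle_integral_def scaleR_add_right)

lemma circle_integral_diff:
  assumes "integrable_circle F" "integrable_circle H"
  shows "circle_integral (\<lambda>z. F z - H z) = circle_integral F - circle_integral H"
  using assms by (simp add: circle_integral_def scaleR_diff_right)

lemma circle_integral_scaleR:
  "circle_integral (\<lambda>z. c *\<^sub>R F z) = c *\<^sub>R circle_integral F"
  by (simp add: circle_integral_def)

lemma circle_integral_const [simp]: "circle_integral (\<lambda>z. c) = c"
  by (simp add: circle_integral_def measure_restrict_space)

lemma circle_integral_mono_AE:
  fixes F H :: "complex \<Rightarrow> real"
  assumes "integrable_circle F" "integrable_circle H" "AE \<theta> in circ. F (cis \<theta>) \<le> H (cis \<theta>)"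
  shows "circle_integral F \<le> circle_integral H"
  using integral_mono_AE[OF assms] by (simp add: circle_integral_def divide_right_mono)

lemma circle_integral_cong:
  assumes "\<And>z. z \<in> sphere 0 1 \<Longrightarrow> F z = H z"
  shows "circle_integral F = circle_integral H"
  using assms by (simp add: circle_integral_def)

lemma circle_integral_nth:
  fixes F :: "complex \<Rightarrow> complex^'a^'b"
  assumes "integrable_circle F"
  shows "circle_integral F $ i $ j = circle_integral (\<lambda>z. F z $ i $ j)"
  by (rule circle_integral_bounded_linear[OF _ assms])
     (intro bounded_linear_compose[OF bounded_linear_vec_nth] bounded_linear_vec_nth)

text \<open>Cramer's rule reduces continuity and holomorphy of an inverse to those of determinants.\<close>

lemma matrix_inv_nth:
  fixes M :: "complex^'n^'n"
  assumes "invertible M"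
  shows "matrix_inv M $ k $ l = det (\<chi> i j. if j = k then axis l 1 $ i else M $ i $ j) / det M"
proof -
  have "M *v (matrix_inv M *v axis l 1) = axis l 1"
    by (simp add: matrix_vector_mul_assoc matrix_inv_works[OF assms])
  moreover have "det M \<noteq> 0" using assms invertible_det_nz by blast
  ultimately have "matrix_inv M *v axis l 1
      = (\<chi> k. det (\<chi> i j. if j = k then axis l 1 $ i else M $ i $ j) / det M)"
    using cramer by blast
  then have "(matrix_inv M *v axis l 1) $ k
      = det (\<chi> i j. if j = k then axis l 1 $ i else M $ i $ j) / det M"
    by simp
  then show ?thesis by (simp add: matrix_vector_mult_axis)
qed

lemma continuous_on_det:
  fixes f :: "'a::topological_space \<Rightarrow> complex^'n^'n"
  assumes "\<And>i j. continuous_on S (\<lambda>x. f x $ i $ j)"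
  shows "continuous_on S (\<lambda>x. det (f x))"
  unfolding det_def by (intro continuous_intros assms)

lemma continuous_on_matrix_inv:
  fixes f :: "'a::topological_space \<Rightarrow> complex^'n^'n"
  assumes f: "continuous_on S f" and inv: "\<And>x. x \<in> S \<Longrightarrow> invertible (f x)"
  shows "continuous_on S (\<lambda>x. matrix_inv (f x))"
proof -
  have e: "continuous_on S (\<lambda>x. f x $ i $ j)" for i j
    by (intro continuous_intros f)
  have "continuous_on S (\<lambda>x. det (\<chi> i j. if j = k then axis l 1 $ i else f x $ i $ j) / det (f x))" for k l
  proof (intro continuous_on_divide continuous_on_det)
    show "continuous_on S (\<lambda>x. (\<chi> i j. if j = k then axis l 1 $ i else f x $ i $ j) $ i $ j)" for i j
      by (cases "j = k") (simp_all add: e)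
    show "\<forall>x\<in>S. det (f x) \<noteq> 0"
      using inv invertible_det_nz by blast
  qed (rule e)
  then have "continuous_on S (\<lambda>x. \<chi> k l. det (\<chi> i j. if j = k then axis l 1 $ i else f x $ i $ j) / det (f x))"
    by (intro continuous_on_vec_lambda)
  then show ?thesis
    by (rule continuous_on_eq) (simp add: vec_eq_iff matrix_inv_nth inv)
qed

lemma holomorphic_on_det:
  fixes f :: "complex \<Rightarrow> complex^'n^'n"
  assumes "\<And>i j. (\<lambda>x. f x $ i $ j) holomorphic_on S"
  shows "(\<lambda>x. det (f x)) holomorphic_on S"
  unfolding det_def by (intro holomorphic_intros assms)

lemma holomorphic_on_matrix_inv_nth:
  fixes f :: "complex \<Rightarrow> complex^'n^'n"
  assumes f: "\<And>i j. (\<lambda>x. f x $ i $ j) holomorphic_on S"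
    and inv: "\<And>x. x \<in> S \<Longrightarrow> invertible (f x)"
  shows "(\<lambda>x. matrix_inv (f x) $ k $ l) holomorphic_on S"
proof -
  have "(\<lambda>x. det (\<chi> i j. if j = k then axis l 1 $ i else f x $ i $ j) / det (f x)) holomorphic_on S"
  proof (intro holomorphic_on_divide holomorphic_on_det)
    show "(\<lambda>x. (\<chi> i j. if j = k then axis l 1 $ i else f x $ i $ j) $ i $ j) holomorphic_on S" for i j
      by (cases "j = k") (simp_all add: f)
    show "\<And>x. x \<in> S \<Longrightarrow> det (f x) \<noteq> 0"
      using inv invertible_det_nz by blast
  qed (rule f)
  then show ?thesis
    by (rule holomorphic_transform) (simp add: matrix_inv_nth inv)
qed

lemma circle_integral_holomorphic:
  assumes f: "f holomorphic_on cball 0 1"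
  shows "circle_integral f = f 0"
proof -
  \<comment> \<open>Cauchy's formula is over $[0,2\pi]$; passing to $f(-z)$ is the shift by $\pi$ to $[-\pi,\pi]$.\<close>
  define g where "g = (\<lambda>z. f (- z))"
  have "f \<circ> uminus holomorphic_on cball 0 1"
    by (rule holomorphic_on_compose_gen[OF _ f]) (auto intro!: holomorphic_intros)
  then have g: "g holomorphic_on cball 0 1" by (simp add: g_def o_def)
  have "((\<lambda>u. g u / (u - 0)) has_contour_integral (2 * of_real pi * \<i> * g 0)) (circlepath 0 1)"
    using Cauchy_integral_circlepath_simple[OF g, of 0] by simp
  then have "((\<lambda>t. g (cis t) / cis t * \<i> * cis t) has_integral (2 * of_real pi * \<i> * g 0)) {0..2*pi}"
    unfolding circlepath_def by (subst (asm) has_contour_integral_part_circlepath_iff) auto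
  then have "((\<lambda>t. \<i> * g (cis t)) has_integral (2 * of_real pi * \<i> * g 0)) {0..2*pi}"
    by (simp add: mult_ac)
  from has_integral_mult_right[OF this, of "-\<i>"]
  have "((\<lambda>t. g (cis t)) has_integral (2 * of_real pi * f 0)) {0..2*pi}"
    by (simp add: g_def algebra_simps)
  then have "((\<lambda>t. g (cis (t + pi))) has_integral (2 * of_real pi * f 0)) {0-pi..2*pi-pi}"
    by (rule has_integral_shift_real_ivl)
  moreover have "g (cis (t + pi)) = f (cis t)" for t
    by (simp add: g_def cis_mult[symmetric])
  ultimately have i: "((\<lambda>t. f (cis t)) has_integral (2 * of_real pi * f 0)) {-pi..pi}"
    by simp
  have "continuous_on (sphere 0 1) f"
    by (rule holomorphic_on_imp_continuous_on[OF holomorphic_on_subset[OF f]]) auto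
  then have "integrable_circle f" by (rule integrable_circ_continuous)
  then have "integral\<^sup>L circ (\<lambda>t. f (cis t)) = 2 * of_real pi * f 0"
    using lebesgue_integral_eq_integral[of "{-pi..pi}" "\<lambda>t. f (cis t)"] integral_unique[OF i] by simp
  then show ?thesis
    by (simp add: circle_integral_def scaleR_conv_of_real)
qed

lemma mat_mult_nth: "(mat w ** N) $ i $ j = w * N $ i $ j" for N :: "complex^'n^'m"
  by (simp add: matrix_matrix_mult_def mat_def if_distrib[of "\<lambda>x. x * _"] cong: if_cong)

text \<open>The entries of $(I - wN)^{-1}$ are analytic in the closed disc, so the mean is the value at \<open>w = 0\<close>.\<close>

lemma circle_integral_resolvent:
  fixes N :: "complex^'n^'n"
  assumes inv: "\<And>w. cmod w \<le> 1 \<Longrightarrow> invertible (mat 1 - mat w ** N)"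
  shows "circle_integral (\<lambda>w. matrix_inv (mat 1 - mat w ** N)) = mat 1"
proof -
  let ?f = "\<lambda>w. mat 1 - mat w ** N"
  have h: "(\<lambda>w. matrix_inv (?f w) $ i $ j) holomorphic_on cball 0 1" for i j
    by (rule holomorphic_on_matrix_inv_nth)
       (use inv in \<open>auto simp: mat_mult_nth intro!: holomorphic_intros\<close>)
  have "continuous_on (sphere 0 1) (\<lambda>w. \<chi> i j. matrix_inv (?f w) $ i $ j)"
    by (intro continuous_on_vec_lambda holomorphic_on_imp_continuous_on holomorphic_on_subset[OF h]) auto
  then have "integrable_circle (\<lambda>w. matrix_inv (?f w))"
    by (intro integrable_circ_continuous) simp
  then have "circle_integral (\<lambda>w. matrix_inv (?f w)) $ i $ j = matrix_inv (?f 0) $ i $ j" for i j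
    by (simp add: circle_integral_nth circle_integral_holomorphic[OF h])
  then show ?thesis
    by (simp add: vec_eq_iff mm.zero_left matrix_inv_unique[of "mat 1" "mat 1"])
qed

lemma cmod_cis_diff_le: "cmod (cis a - cis b) \<le> \<bar>a - b\<bar>"
proof -
  have "cis a - cis b = cis b * (cis (a - b) - 1)"
    by (simp add: right_diff_distrib cis_mult)
  then have "cmod (cis a - cis b) = 2 * \<bar>sin ((a - b) / 2)\<bar>"
    by (simp only: norm_mult norm_cis cis_conv_exp[of "a - b"] dist_exp_i_1 mult_1)
  also have "\<dots> \<le> 2 * \<bar>(a - b) / 2\<bar>"
    by (intro mult_left_mono abs_sin_x_le_abs_x) simp
  finally show ?thesis by simp
qed

lemma circle_integral_nonneg:
  fixes F :: "complex \<Rightarrow> real"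
  assumes "\<And>z. z \<in> sphere 0 1 \<Longrightarrow> 0 \<le> F z"
  shows "0 \<le> circle_integral F"
  unfolding circle_integral_def using assms by (auto intro!: divide_nonneg_pos integral_nonneg_AE)

lemma circle_integral_continuous_nonpos:
  fixes F :: "complex \<Rightarrow> real"
  assumes c: "continuous_on (sphere 0 1) F" and nn: "\<And>z. z \<in> sphere 0 1 \<Longrightarrow> 0 \<le> F z"
    and le: "circle_integral F \<le> 0" and z: "z \<in> sphere 0 1"
  shows "F z = 0"
proof -
  have "integral\<^sup>L circ (\<lambda>\<theta>. F (cis \<theta>)) \<le> 0"
    using le by (simp add: circle_integral_def field_simps)
  moreover have "0 \<le> integral\<^sup>L circ (\<lambda>\<theta>. F (cis \<theta>))"
    using nn by (intro integral_nonneg_AE) simp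
  ultimately have "integral\<^sup>L circ (\<lambda>\<theta>. F (cis \<theta>)) = 0" by simp
  then have "integral {-pi..pi} (\<lambda>\<theta>. F (cis \<theta>)) = 0"
    using lebesgue_integral_eq_integral[OF integrable_circ_continuous[OF c]] by simp
  then have "\<forall>\<theta>\<in>{-pi..pi}. F (cis \<theta>) = 0"
    by (subst (asm) integral_eq_0_iff) (auto intro!: continuous_on_cis_compose c nn)
  then show ?thesis using sphere_obtain_angle[OF z] by metis
qed

section \<open>Congruences and uniform positivity\<close>

lemma mat_mult_vec: "mat z *v x = z *s x" for x :: "complex^'a"
  by (simp add: vec_eq_iff matrix_vector_mult_def mat_def if_distrib[of "\<lambda>x. x * _"] cong: if_cong)

lemma mat_of_real_mult_vec: "mat (complex_of_real c) *v x = c *\<^sub>R x" for x :: "complex^'a"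
  by (simp add: mat_mult_vec vec_eq_iff) (simp add: scaleR_conv_of_real)

lemma mat_commute: "mat z ** M = M ** mat z" for M :: "complex^'a^'b"
  by (simp add: vec_eq_iff mat_mult_nth)
     (simp add: matrix_matrix_mult_def mat_def if_distrib[of "\<lambda>x. _ * x"] mult.commute cong: if_cong)

lemma mat_mult_mat: "mat z ** mat w = (mat (z * w) :: complex^'a^'a)"
  by (simp add: vec_eq_iff mat_mult_nth) (simp add: mat_def)

lemma continuous_on_mat [continuous_intros]:
  "continuous_on S f \<Longrightarrow> continuous_on S (\<lambda>z. mat (f z) :: complex^'a^'a)"
proof -
  assume f: "continuous_on S f"
  have "continuous_on S (\<lambda>z. if i = j then f z else 0)" for i j :: 'a
    using f by (cases "i = j") auto
  then show ?thesis unfolding mat_def by (intro continuous_on_vec_lambda)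
qed

lemmas continuous_on_mm [continuous_intros] = mm.continuous_on
lemmas continuous_on_ctrans [continuous_intros] = bounded_linear.continuous_on[OF bounded_linear_ctrans]

lemma continuous_on_Re_trace [continuous_intros]:
  fixes f :: "'b::topological_space \<Rightarrow> complex^'a^'a"
  shows "continuous_on X f \<Longrightarrow> continuous_on X (\<lambda>x. Re (trace (f x)))"
  by (rule bounded_linear.continuous_on[OF bounded_linear_compose[OF bounded_linear_Re bounded_linear_trace]])

lemma bounded_bilinear_matrix_vector_mult:
  "bounded_bilinear ((*v) :: complex^'a^'b \<Rightarrow> complex^'a \<Rightarrow> complex^'b)"
  by (intro bilinear_conv_bounded_bilinear[THEN iffD1])
     (simp add: bilinear_def linear_iff matrix_vector_mult_scaleR_complex matrix_vector_right_distrib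
        matrix_vector_mult_add_rdistrib, simp add: vec_eq_iff matrix_vector_mult_def scaleR_sum_right)

lemmas continuous_on_mv = bounded_bilinear.continuous_on[OF bounded_bilinear_matrix_vector_mult]

lemma congruence_unimodular:
  fixes X :: "complex^'a^'b"
  assumes "z \<in> sphere 0 1"
  shows "(mat z ** X) ** P ** ctrans (mat z ** X) = X ** P ** ctrans X"
proof -
  have zz: "z * cnj z = 1" using assms complex_norm_square[of z] by simp
  have "(mat z ** X) ** P ** ctrans (mat z ** X) = mat z ** (X ** P ** ctrans X) ** mat (cnj z)"
    by (simp add: ctrans_mult matrix_mul_assoc)
  also have "\<dots> = (X ** P ** ctrans X) ** (mat z ** mat (cnj z))"
    by (metis mat_commute matrix_mul_assoc)
  finally show ?thesis by (simp add: mat_mult_mat zz)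
qed

lemma ctrans_inverse:
  fixes M :: "complex^'a^'a"
  assumes "M ** X = mat 1"
  shows "ctrans X ** ctrans M = mat 1" "ctrans M ** ctrans X = mat 1"
proof -
  show "ctrans X ** ctrans M = mat 1"
    using arg_cong[OF assms, of ctrans] by (simp add: ctrans_mult)
  then show "ctrans M ** ctrans X = mat 1"
    by (simp add: matrix_left_right_inverse)
qed

lemma invertible_ctrans: "invertible M \<Longrightarrow> invertible (ctrans M)" for M :: "complex^'a^'a"
  using ctrans_inverse matrix_inv_works(1) invertible_right_inverse by blast

lemma herm_congruence: "herm P \<Longrightarrow> herm (ctrans E ** P ** E)" for P :: "complex^'a^'a"
  by (simp add: herm_def ctrans_mult matrix_mul_assoc)

lemma nonneg_def_congruence: "nonneg_def P \<Longrightarrow> nonneg_def (ctrans E ** P ** E)"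
  by (simp add: nonneg_def_def herm_congruence inner_congruence)

lemma pos_def_congruence:
  fixes P :: "complex^'a^'a"
  assumes "pos_def P" "\<And>v. E *v v = 0 \<Longrightarrow> v = 0"
  shows "pos_def (ctrans E ** P ** E)"
  using assms by (auto simp: pos_def_def herm_congruence inner_congruence)

text \<open>The quadratic form attains its minimum on the compact product of \<open>X\<close> with the unit sphere.\<close>

lemma pos_def_coercive:
  fixes \<Phi> :: "'b::metric_space \<Rightarrow> complex^'a^'a"
  assumes X: "compact X" "X \<noteq> {}" and c: "continuous_on X \<Phi>" and p: "\<And>z. z \<in> X \<Longrightarrow> pos_def (\<Phi> z)"
  obtains c where "0 < c" "\<And>z. z \<in> X \<Longrightarrow> pos_def (\<Phi> z - mat (of_real c))"
proof -
  let ?S = "X \<times> sphere (0::complex^'a) 1"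
  let ?g = "\<lambda>(z, v). v \<bullet> (\<Phi> z *v v)"
  have cont: "continuous_on ?S ?g"
    unfolding split_def
    by (intro continuous_on_inner continuous_on_mv continuous_on_compose2[OF c]
        continuous_on_fst continuous_on_snd continuous_on_id) auto
  have "axis undefined 1 \<in> sphere (0::complex^'a) 1" by simp
  then have "?S \<noteq> {}" using X by blast
  then obtain s0 where s0: "s0 \<in> ?S" "\<And>s. s \<in> ?S \<Longrightarrow> ?g s0 \<le> ?g s"
    using continuous_attains_inf[OF compact_Times[OF X(1) compact_sphere] _ cont] by blast
  obtain z0 v0 where "s0 = (z0, v0)" by (cases s0)
  with s0 have m: "(z0, v0) \<in> ?S" "\<And>s. s \<in> ?S \<Longrightarrow> ?g (z0, v0) \<le> ?g s" by blast+
  define c where "c = v0 \<bullet> (\<Phi> z0 *v v0)"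
  have "v0 \<noteq> 0" using m(1) by auto
  then have c0: "0 < c" using m(1) p by (auto simp: c_def pos_def_def)
  have low: "c * (v \<bullet> v) \<le> v \<bullet> (\<Phi> z *v v)" if z: "z \<in> X" for z v
  proof (cases "v = 0")
    case False
    define w where "w = v /\<^sub>R norm v"
    have v: "v = norm v *\<^sub>R w" using False by (simp add: w_def)
    have "c \<le> w \<bullet> (\<Phi> z *v w)" using m(2)[of "(z, w)"] z False by (simp add: c_def w_def)
    then have "c * (norm v)\<^sup>2 \<le> (norm v)\<^sup>2 * (w \<bullet> (\<Phi> z *v w))"
      by (subst mult.commute[of "(norm v)\<^sup>2"]) (rule mult_right_mono, auto)
    also have "\<dots> = v \<bullet> (\<Phi> z *v v)"
    proof -
      have "v \<bullet> (\<Phi> z *v v) = (norm v *\<^sub>R w) \<bullet> (\<Phi> z *v (norm v *\<^sub>R w))"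
        using v by simp
      then show ?thesis by (simp add: matrix_vector_mult_scaleR_complex power2_eq_square)
    qed
    finally show ?thesis by (simp add: dot_square_norm)
  qed simp
  \<comment> \<open>Half of the minimum, since the difference has to stay strictly positive.\<close>
  have "pos_def (\<Phi> z - mat (of_real (c/2)))" if z: "z \<in> X" for z
  proof -
    have "herm (\<Phi> z - mat (of_real (c/2)))"
      using p[OF z] by (simp add: pos_def_def herm_def ctrans_diff)
    moreover have "0 < v \<bullet> ((\<Phi> z - mat (of_real (c/2))) *v v)" if "v \<noteq> 0" for v
    proof -
      have "0 < c / 2 * (v \<bullet> v)" using c0 that by simp
      then show ?thesis using low[OF z, of v]
        by (simp only: matrix_vector_mult_diff_rdistrib mat_of_real_mult_vec inner_diff_right inner_scaleR_right)
    qed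
    ultimately show ?thesis by (auto simp: pos_def_def)
  qed
  then show thesis using that[of "c/2"] c0 by simp
qed

lemma full_column_rank_ker:
  fixes B :: "complex^'m^'n"
  assumes "rank B = CARD('m)" "B *v x = 0"
  shows "x = 0"
proof -
  have "vec.dim (rows B) = vec.dim (UNIV :: (complex^'m) set)"
    using assms(1) by (simp only: row_rank_def_gen vec_dim_card)
  then have "vec.span (rows B) = UNIV"
    using vec.dim_eq_full[of "rows B"] by (simp add: vec.dimension_def vec.dim_UNIV)
  then show ?thesis
    using assms(2) matrix_left_invertible_span_rows_gen[of B] matrix_left_invertible_ker[of B] by blast
qed

text \<open>A spectral density is only measurable and bounded; the factors around it are continuous.\<close>

lemma integrable_measurable_symbol:
  fixes \<Phi> :: "complex \<Rightarrow> complex^'c^'a" and L :: "complex \<Rightarrow> complex^'a^'b"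
    and R :: "complex \<Rightarrow> complex^'d^'c"
  assumes m: "(\<lambda>\<theta>. \<Phi> (cis \<theta>)) \<in> borel_measurable circ" and b: "bounded (\<Phi> ` sphere 0 1)"
    and L: "continuous_on (sphere 0 1) L" and R: "continuous_on (sphere 0 1) R"
  shows "integrable_circle (\<lambda>z. L z ** \<Phi> z ** R z)"
  proof -
  have meas: "(\<lambda>\<theta>. L (cis \<theta>) ** \<Phi> (cis \<theta>) ** R (cis \<theta>)) \<in> borel_measurable circ"
    by (intro borel_measurable_continuous_Pair[where H = "(**)"] m measurable_circ_continuous[OF L]
        measurable_circ_continuous[OF R]) (auto intro!: continuous_intros)
  obtain K1 where K1: "0 < K1" "\<And>(X::complex^'a^'b) (Y::complex^'c^'a). norm (X ** Y) \<le> norm X * norm Y * K1"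
    using mm.pos_bounded by blast
  obtain K2 where K2: "0 < K2" "\<And>(X::complex^'c^'b) (Y::complex^'d^'c). norm (X ** Y) \<le> norm X * norm Y * K2"
    using mm.pos_bounded by blast
  obtain CL where CL: "0 < CL" "\<And>z. z \<in> sphere 0 1 \<Longrightarrow> norm (L z) \<le> CL"
    using continuous_sphere_bounded[OF L] by blast
  obtain CR where CR: "0 < CR" "\<And>z. z \<in> sphere 0 1 \<Longrightarrow> norm (R z) \<le> CR"
    using continuous_sphere_bounded[OF R] by blast
  obtain CP where CP: "0 < CP" "\<And>z. z \<in> sphere 0 1 \<Longrightarrow> norm (\<Phi> z) \<le> CP"
    using b unfolding bounded_pos by blast
  note C = CL CR CP
  have "norm (L z ** \<Phi> z ** R z) \<le> CL * CP * K1 * CR * K2" if z: "z \<in> sphere 0 1" for z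
  proof -
    have "norm (L z ** \<Phi> z) \<le> norm (L z) * norm (\<Phi> z) * K1" by (rule K1)
    also have "\<dots> \<le> CL * CP * K1" using C(1,3,5) CL(2)[OF z] CP(2)[OF z] K1(1) by (intro mult_mono) auto
    finally have "norm (L z ** \<Phi> z) * norm (R z) * K2 \<le> CL * CP * K1 * CR * K2"
      using C(1,3,5) CR(2)[OF z] K1(1) K2(1) by (intro mult_mono) auto
    then show ?thesis using K2(2)[of "L z ** \<Phi> z" "R z"] by linarith
  qed
  then show ?thesis
    by (intro integrable_circ_bounded[OF meas, where C = "CL * CP * K1 * CR * K2"]) simp
qed

lemma S_plusD:
  assumes "\<Phi> \<in> S_plus"
  shows "(\<lambda>\<theta>. \<Phi> (cis \<theta>)) \<in> borel_measurable circ" "bounded (\<Phi> ` sphere 0 1)"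
    "\<And>z. z \<in> sphere 0 1 \<Longrightarrow> nonneg_def (\<Phi> z)"
  using assms by (auto simp: S_plus_def)

lemma continuous_pos_def_in_S_plus:
  assumes c: "continuous_on (sphere 0 1) \<Phi>" and p: "\<And>z. z \<in> sphere 0 1 \<Longrightarrow> pos_def (\<Phi> z)"
  shows "\<Phi> \<in> S_plus"
proof -
  obtain c where "0 < c" "\<And>z. z \<in> sphere 0 1 \<Longrightarrow> pos_def (\<Phi> z - mat (of_real c))"
    using pos_def_coercive[OF compact_sphere _ assms] by auto
  then have "\<exists>c::real. 0 < c \<and> (AE \<theta> in circ. pos_def (\<Phi> (cis \<theta>) - mat (of_real c)))"
    by (intro exI[of _ c]) simp
  then show ?thesis
    using measurable_circ_continuous[OF c] compact_imp_bounded[OF compact_continuous_image[OF c compact_sphere]] p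
    by (auto simp: S_plus_def pos_def_imp_nonneg_def)
qed

lemma Re_trace_mult_bound:
  obtains K where "0 < K" "\<And>(X::complex^'b^'a) Y. \<bar>Re (trace (X ** Y))\<bar> \<le> K * norm X * norm Y"
proof -
  obtain K1 where K1: "0 < K1" "\<And>(X::complex^'b^'a) (Y::complex^'a^'b). norm (X ** Y) \<le> norm X * norm Y * K1"
    using mm.pos_bounded by blast
  obtain K2 where K2: "0 < K2" "\<And>Z::complex^'a^'a. norm (trace Z) \<le> norm Z * K2"
    using bounded_linear.pos_bounded[OF bounded_linear_trace] by blast
  have "\<bar>Re (trace (X ** Y))\<bar> \<le> (K1 * K2) * norm X * norm Y" for X :: "complex^'b^'a" and Y
  proof -
    have "\<bar>Re (trace (X ** Y))\<bar> \<le> norm (X ** Y) * K2"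
      using abs_Re_le_cmod K2(2) order_trans by blast
    also have "\<dots> \<le> norm X * norm Y * K1 * K2"
      by (rule mult_right_mono[OF K1(2)]) (use K2 in simp)
    finally show ?thesis by (simp add: mult_ac)
  qed
  then show thesis using that[of "K1 * K2"] K1(1) K2(1) by simp
qed

lemma matrix_vector_mult_bound:
  obtains K where "0 < K" "\<And>(M::complex^'a^'b) x. norm (M *v x) \<le> K * norm M * norm x"
proof -
  obtain K where "0 < K" "\<And>(M::complex^'a^'b) x. norm (M *v x) \<le> norm M * norm x * K"
    using bounded_bilinear.pos_bounded[OF bounded_bilinear_matrix_vector_mult] by blast
  then show thesis using that[of K] by (simp add: mult_ac)
qed

lemma bounded_linear_mat: "bounded_linear (mat :: complex \<Rightarrow> complex^'a^'a)"
  by (intro linear_conv_bounded_linear[THEN iffD1] linearI) (simp_all add: vec_eq_iff mat_def)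

lemma nonneg_def_mat_diff_trace:
  fixes P R :: "complex^'a^'a"
  assumes "nonneg_def (P - mat (of_real c))" "nonneg_def R"
  shows "c * Re (trace R) \<le> Re (trace (P ** R))"
proof -
  have "trace (mat (of_real c) ** R) = of_real c * trace R"
    by (simp add: trace_def mat_mult_nth sum_distrib_left)
  then show ?thesis
    using trace_mult_nonneg[OF assms] by (simp add: mm.diff_left trace_sub)
qed

lemma nonneg_def_trace_eq_0: "nonneg_def P \<Longrightarrow> Re (trace P) = 0 \<Longrightarrow> P = 0"
  using nonneg_def_norm_le[of P] by simp

lemma congruence_eq_0:
  fixes P :: "complex^'a^'a"
  assumes "pos_def P" "ctrans E ** P ** E = 0"
  shows "E = 0"
proof -
  have "E *v v = 0" for v
  proof (rule ccontr)
    assume "E *v v \<noteq> 0"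
    then have "0 < (E *v v) \<bullet> (P *v (E *v v))" using assms(1) by (auto simp: pos_def_def)
    then show False by (simp add: assms(2) flip: inner_congruence)
  qed
  then show ?thesis by (simp add: matrix_eq)
qed

lemma C_herm_measurable_bounded:
  assumes "\<Phi> \<in> C_herm"
  shows "(\<lambda>\<theta>. \<Phi> (cis \<theta>)) \<in> borel_measurable circ" "bounded (\<Phi> ` sphere 0 1)"
  using assms measurable_circ_continuous compact_imp_bounded[OF compact_continuous_image[OF _ compact_sphere]]
  by (auto simp: C_herm_def)

lemma integrable_trace:
  fixes \<Phi> R :: "complex \<Rightarrow> complex^'m^'m"
  assumes m: "(\<lambda>\<theta>. \<Phi> (cis \<theta>)) \<in> borel_measurable circ" and b: "bounded (\<Phi> ` sphere 0 1)"
    and R: "continuous_on (sphere 0 1) R"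
  shows "integrable_circle (\<lambda>z. Re (trace (\<Phi> z ** R z)))"
    "integrable_circle (\<lambda>z. Re (trace (R z ** \<Phi> z)))"
proof -
  have "integrable_circle (\<lambda>z. mat 1 ** \<Phi> z ** R z)"
    by (rule integrable_measurable_symbol[OF m b _ R]) simp
  then have "integrable_circle (\<lambda>z. \<Phi> z ** R z)" by simp
  from integrable_bounded_linear[OF bounded_linear_compose[OF bounded_linear_Re bounded_linear_trace] this]
  show 1: "integrable_circle (\<lambda>z. Re (trace (\<Phi> z ** R z)))" by simp
  have e: "trace (R z ** \<Phi> z) = trace (\<Phi> z ** R z)" for z by (rule trace_mul_sym)
  show "integrable_circle (\<lambda>z. Re (trace (R z ** \<Phi> z)))" unfolding e by (rule 1)
qed

text \<open>Integrated form of the monotonicity of $P \mapsto \mathrm{tr}\,PR$ for $R \ge 0$, applied to $\Phi \ge cI$.\<close>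

lemma S_plus_trace_ge:
  fixes \<Phi> :: "complex \<Rightarrow> complex^'m^'m"
  assumes "\<Phi> \<in> S_plus"
  obtains c where "0 < c"
    "\<forall>R. (\<forall>z\<in>sphere 0 1. nonneg_def (R z)) \<longrightarrow> continuous_on (sphere 0 1) R \<longrightarrow>
      c * circle_integral (\<lambda>z. Re (trace (R z))) \<le> circle_integral (\<lambda>z. Re (trace (\<Phi> z ** R z)))"
proof -
  obtain c :: real where c: "0 < c" "AE \<theta> in circ. pos_def (\<Phi> (cis \<theta>) - mat (of_real c))"
    using assms by (auto simp: S_plus_def)
  have n: "AE \<theta> in circ. nonneg_def (\<Phi> (cis \<theta>) - mat (of_real c))"
    using c(2) by (rule AE_mp) (simp add: pos_def_imp_nonneg_def)
  show thesis
  proof (rule that[OF c(1)], intro allI impI)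
    fix R :: "complex \<Rightarrow> complex^'m^'m"
    assume R: "\<forall>z\<in>sphere 0 1. nonneg_def (R z)" "continuous_on (sphere 0 1) R"
    have "circle_integral (\<lambda>z. c *\<^sub>R Re (trace (R z))) \<le> circle_integral (\<lambda>z. Re (trace (\<Phi> z ** R z)))"
    proof (rule circle_integral_mono_AE)
      show "integrable_circle (\<lambda>z. c *\<^sub>R Re (trace (R z)))"
        by (intro integrable_circ_continuous continuous_intros R)
      show "integrable_circle (\<lambda>z. Re (trace (\<Phi> z ** R z)))"
        by (rule integrable_trace[OF S_plusD(1,2)[OF assms] R(2)])
      show "AE \<theta> in circ. c *\<^sub>R Re (trace (R (cis \<theta>))) \<le> Re (trace (\<Phi> (cis \<theta>) ** R (cis \<theta>)))"
        unfolding real_scaleR_def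
        by (rule AE_mp[OF n]) (intro AE_I2 impI nonneg_def_mat_diff_trace R(1)[rule_format] cis_in_sphere)
    qed
    then show "c * circle_integral (\<lambda>z. Re (trace (R z))) \<le> circle_integral (\<lambda>z. Re (trace (\<Phi> z ** R z)))"
      using circle_integral_scaleR[of c "\<lambda>z. Re (trace (R z))"] by simp
  qed
qed

section \<open>The interpolation filter and feasibility\<close>

locale stable_filter =
  fixes A :: "complex^'n^'n" and B :: "complex^'m^'n"
  assumes stable: "\<And>l. eigenvalue A l \<Longrightarrow> l \<in> ball 0 1"
    and full_rank: "rank B = CARD('m)"
begin

abbreviation G :: "complex \<Rightarrow> complex^'m^'n" where "G \<equiv> transfer A B"

abbreviation S :: "complex^'m^'m" where "S \<equiv> ctrans B ** B"

abbreviation C :: "complex^'n^'n" where "C \<equiv> mat 1 - Pi_proj B"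

lemma B_ker: "B *v x = 0 \<Longrightarrow> x = 0"
  using full_column_rank_ker[OF full_rank] .

lemma invertible_resolvent:
  assumes "z \<in> sphere 0 1"
  shows "invertible (mat z - A)"
  unfolding invertible_ker
proof (intro allI impI)
  fix x assume "(mat z - A) *v x = 0"
  then have "A *v x = z *s x" by (simp add: matrix_vector_mult_diff_rdistrib mat_mult_vec)
  then show "x = 0" using stable[of z] assms by (auto simp: eigenvalue_def)
qed

lemma resolvent_transfer: "z \<in> sphere 0 1 \<Longrightarrow> (mat z - A) ** G z = B"
  unfolding transfer_def by (simp add: matrix_mul_assoc matrix_inv_works invertible_resolvent)

lemma continuous_on_transfer [continuous_intros]: "continuous_on (sphere 0 1) G"
  unfolding transfer_def
  by (intro continuous_intros continuous_on_matrix_inv invertible_resolvent)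

lemma pos_def_S: "pos_def S"
  using pos_def_congruence[OF pos_def_mat_1, of B] B_ker by simp

lemma S_inv: "S ** matrix_inv S = mat 1" "matrix_inv S ** S = mat 1"
  using matrix_inv_works pos_def_imp_invertible[OF pos_def_S] by blast+

lemma Pi_proj_B: "Pi_proj B ** B = B" and B_Pi_proj: "ctrans B ** Pi_proj B = ctrans B"
  unfolding Pi_proj_def
  by (metis S_inv matrix_mul_assoc matrix_mul_lid matrix_mul_rid)+

lemma herm_Pi_proj: "ctrans (Pi_proj B) = Pi_proj B"
  using pos_def_matrix_inv[OF pos_def_S]
  by (simp add: Pi_proj_def ctrans_mult pos_def_def herm_def matrix_mul_assoc)

lemma C_B: "C ** B = 0" and B_C: "ctrans B ** C = 0"
  by (simp_all add: mm.diff_left mm.diff_right Pi_proj_B B_Pi_proj)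

lemma ctrans_C: "ctrans C = C"
  by (simp add: ctrans_diff herm_Pi_proj)

lemma C_C: "C ** C = C"
proof -
  have "C ** Pi_proj B = 0"
    by (simp add: Pi_proj_def matrix_mul_assoc C_B[unfolded Pi_proj_def] mm.zero_left)
  then show ?thesis by (simp add: mm.diff_right[of C])
qed

lemma integrable_Gam:
  assumes "(\<lambda>\<theta>. \<Phi> (cis \<theta>)) \<in> borel_measurable circ" "bounded (\<Phi> ` sphere 0 1)"
  shows "integrable_circle (\<lambda>z. G z ** \<Phi> z ** ctrans (G z))"
  by (rule integrable_measurable_symbol[OF assms]) (intro continuous_intros)+

lemma circle_integral_congruence:
  fixes F :: "complex \<Rightarrow> complex^'n^'n"
  assumes "integrable_circle F"
  shows "M ** circle_integral F ** ctrans M = circle_integral (\<lambda>z. M ** F z ** ctrans M)"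
  by (rule circle_integral_bounded_linear[OF _ assms])
     (rule bounded_linear_compose[OF mm.bounded_linear_left mm.bounded_linear_right])

lemma condition_iff: "C ** (mat 1 - A ** ctrans A) ** C = 0 \<longleftrightarrow> (C ** A) ** ctrans (C ** A) = C"
proof -
  have "D ** (mat 1 - A ** ctrans A) ** D = D ** D - D ** A ** ctrans A ** D" for D
    by (simp add: mm.diff_left mm.diff_right matrix_mul_assoc)
  from this[of C] have "C ** (mat 1 - A ** ctrans A) ** C = C - (C ** A) ** ctrans (C ** A)"
    by (simp only: C_C ctrans_mult ctrans_C matrix_mul_assoc)
  then show ?thesis
    by (simp only: right_minus_eq) (rule eq_commute)
qed

text \<open>On the circle $C A G = C(zG - B) = z\,CG$, and the unimodular factor disappears from
  $CAG\,\Phi\,(CAG)^*$. Hence a state covariance equal to \<open>I\<close> gives $CAA^*C = C$.\<close>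

lemma feasible_imp_condition:
  assumes "feasible A B"
  shows "C ** (mat 1 - A ** ctrans A) ** C = 0"
proof -
  obtain \<Phi> where \<Phi>: "\<Phi> \<in> S_plus" and I: "Gam A B \<Phi> = mat 1"
    using assms by (auto simp: feasible_def)
  let ?F = "\<lambda>z. G z ** \<Phi> z ** ctrans (G z)"
  have int: "integrable_circle ?F" by (rule integrable_Gam[OF S_plusD(1,2)[OF \<Phi>]])
  have 1: "circle_integral ?F = mat 1" using I by (simp add: Gam_def)
  have "(C ** A) ** ?F z ** ctrans (C ** A) = C ** ?F z ** ctrans C" if z: "z \<in> sphere 0 1" for z
  proof -
    have "A ** G z = mat z ** G z - B"
      using resolvent_transfer[OF z] by (simp add: mm.diff_left algebra_simps)
    then have "C ** A ** G z = C ** (mat z ** G z - B)" by (simp flip: matrix_mul_assoc)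
    also have "\<dots> = mat z ** (C ** G z)"
      by (simp add: mm.diff_right[of C] C_B matrix_mul_assoc mat_commute[of z C])
    finally have "C ** A ** G z ** \<Phi> z ** ctrans (C ** A ** G z) = (C ** G z) ** \<Phi> z ** ctrans (C ** G z)"
      by (simp only: congruence_unimodular[OF z])
    then show ?thesis by (simp add: ctrans_mult matrix_mul_assoc)
  qed
  then have "(C ** A) ** circle_integral ?F ** ctrans (C ** A) = C ** circle_integral ?F ** ctrans C"
    unfolding circle_integral_congruence[OF int] by (rule circle_integral_cong)
  then have "(C ** A) ** mat 1 ** ctrans (C ** A) = C ** mat 1 ** ctrans C"
    by (simp only: 1)
  then show ?thesis by (simp only: condition_iff ctrans_C C_C matrix_mul_rid)
qed

text \<open>By hypothesis \<open>F = CA\<close> has $FF^* = C = I - \Pi_B$, so \<open>F\<close> is a contraction. It has no unimodular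
  eigenvalue: where $F^*$ preserves the length of \<open>x\<close>, $B^*x = 0$ and hence $F^*x = A^*x$, so \<open>A\<close> would have one
  too. Therefore $U = (I - \bar zF)^{-1}$ exists and has mean \<open>I\<close>. From $U\,\bar zF = U - I$,
  $$U\,\Pi_B\,U^* = UU^* - (U-I)(U-I)^* = U + U^* - I ,$$
  which integrates to \<open>I\<close>. It remains to see that the left-hand side is $G\Phi G^*$. The feedback
  $F = A - B(B^*B)^{-1}B^*A$ gives $(zI-F)^{-1}B = GN$ with $N = I - (B^*B)^{-1}B^*A(zI-F)^{-1}B$, and so
  $\Phi = N(B^*B)^{-1}N^*$ will do.\<close>

lemma condition_imp_feasible:
  assumes "C ** (mat 1 - A ** ctrans A) ** C = 0"
  shows "feasible A B"
proof -
  define F where "F = C ** A"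
  have FF: "F ** ctrans F = C"
    using assms unfolding condition_iff F_def .
  have AF: "A = F + Pi_proj B ** A" by (simp add: F_def mm.diff_left)
  have inv: "invertible (mat 1 - mat w ** ctrans F)" if w: "cmod w \<le> 1" for w
    unfolding invertible_ker
  proof (intro allI impI, rule ccontr)
    fix x assume "(mat 1 - mat w ** ctrans F) *v x = 0" and x: "x \<noteq> 0"
    then have e: "x = w *s (ctrans F *v x)"
      by (simp add: matrix_vector_mult_diff_rdistrib mat_mult_vec flip: matrix_vector_mul_assoc)
    have nle: "norm (w *s v) \<le> norm v" for v :: "complex^'n"
      unfolding norm_vec_def using w by (intro L2_set_mono) (auto simp: norm_mult mult_left_le_one_le)
    have "x \<bullet> x \<le> (ctrans F *v x) \<bullet> (ctrans F *v x)"
      using nle[of "ctrans F *v x"] e by (simp flip: norm_le)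
    also have "\<dots> = x \<bullet> (C *v x)"
      by (simp add: inner_ctrans matrix_vector_mul_assoc FF)
    also have "\<dots> = x \<bullet> x - x \<bullet> (Pi_proj B *v x)"
      by (simp add: matrix_vector_mult_diff_rdistrib inner_diff_right)
    also have "x \<bullet> (Pi_proj B *v x) = (ctrans B *v x) \<bullet> (matrix_inv S *v (ctrans B *v x))"
      using inner_congruence[of x "ctrans B" "matrix_inv S"] by (simp add: Pi_proj_def)
    finally have "(ctrans B *v x) \<bullet> (matrix_inv S *v (ctrans B *v x)) \<le> 0" by simp
    then have "ctrans B *v x = 0"
      using pos_def_matrix_inv[OF pos_def_S] unfolding pos_def_def by (meson not_le)
    then have Cx: "C *v x = x"
      by (simp add: matrix_vector_mult_diff_rdistrib Pi_proj_def flip: matrix_vector_mul_assoc)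
    have "ctrans F *v x = ctrans A *v x"
      by (simp add: F_def ctrans_mult ctrans_C Cx flip: matrix_vector_mul_assoc)
    with e have e': "x = w *s (ctrans A *v x)" by simp
    then have w0: "w \<noteq> 0" using x by auto
    have "\<not> invertible (mat (1/w) - ctrans A)"
    proof -
      have "mat (1/w) *v x = ctrans A *v x"
        using w0 by (subst e') (simp add: mat_mult_vec)
      then show ?thesis using x unfolding invertible_ker
        by (auto simp: matrix_vector_mult_diff_rdistrib)
    qed
    then have "\<not> invertible (mat (cnj (1/w)) - A)"
      using invertible_ctrans[of "mat (cnj (1/w)) - A"] by (auto simp: ctrans_diff)
    then obtain y where "y \<noteq> 0" "A *v y = cnj (1/w) *s y"
      unfolding invertible_ker by (auto simp: matrix_vector_mult_diff_rdistrib mat_mult_vec)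
    then have "cmod (cnj (1/w)) < 1" using stable[of "cnj (1/w)"] by (auto simp: eigenvalue_def)
    then show False using w w0 by (simp add: norm_divide)
  qed
  \<comment> \<open>The mean value property applies to the function \<open>T\<close>, analytic in the closed disc; \<open>U\<close> is its
    conjugate transpose on the circle.\<close>
  define T where "T = (\<lambda>z. matrix_inv (mat 1 - mat z ** ctrans F))"
  define U where "U = (\<lambda>z. ctrans (T z))"
  have contT: "continuous_on (sphere 0 1) T"
    unfolding T_def by (intro continuous_intros continuous_on_matrix_inv inv) simp
  have contU: "continuous_on (sphere 0 1) U"
    unfolding U_def by (intro continuous_intros contT)
  have U: "U z ** (mat 1 - mat (cnj z) ** F) = mat 1" "(mat 1 - mat (cnj z) ** F) ** U z = mat 1"
    if z: "z \<in> sphere 0 1" for z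
  proof -
    have "(mat 1 - mat z ** ctrans F) ** T z = mat 1"
      using matrix_inv_works(1)[OF inv[of z]] z by (simp add: T_def)
    from ctrans_inverse[OF this]
    show "U z ** (mat 1 - mat (cnj z) ** F) = mat 1" "(mat 1 - mat (cnj z) ** F) ** U z = mat 1"
      by (simp_all add: U_def ctrans_diff ctrans_mult mat_commute)
  qed
  have intT: "circle_integral T = mat 1"
    unfolding T_def by (rule circle_integral_resolvent[OF inv])
  have intU: "circle_integral U = mat 1"
    using circle_integral_bounded_linear[OF bounded_linear_ctrans integrable_circ_continuous[OF contT]]
    by (simp add: U_def intT)
  \<comment> \<open>On the circle $\bar z\,U = (zI-F)^{-1}$.\<close>
  define X where "X = (\<lambda>z. mat (cnj z) ** U z ** B)"
  define N where "N = (\<lambda>z. mat 1 - matrix_inv S ** ctrans B ** A ** X z)"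
  define \<Phi> where "\<Phi> = (\<lambda>z. N z ** matrix_inv S ** ctrans (N z))"
  have GN: "G z ** N z = X z" if z: "z \<in> sphere 0 1" for z
  proof -
    have zz: "z * cnj z = 1" using z complex_norm_square[of z] by simp
    have "(mat z - F) ** X z = (mat z ** mat (cnj z) - F ** mat (cnj z)) ** U z ** B"
      by (simp add: X_def mm.diff_left matrix_mul_assoc)
    also have "\<dots> = (mat 1 - mat (cnj z) ** F) ** U z ** B"
      by (simp add: mat_mult_mat zz mat_commute[of "cnj z" F])
    finally have 1: "(mat z - F) ** X z = B" by (simp add: U(2)[OF z])
    have "(mat z - A) ** X z = (mat z - F) ** X z - Pi_proj B ** A ** X z"
      by (subst AF) (simp only: mm.diff_left mm.add_left diff_diff_eq)
    also have "\<dots> = B ** N z"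
      by (simp only: 1 N_def mm.diff_right Pi_proj_def matrix_mul_assoc matrix_mul_rid)
    finally have "matrix_inv (mat z - A) ** ((mat z - A) ** X z) = G z ** N z"
      by (simp add: transfer_def matrix_mul_assoc)
    then show ?thesis
      by (simp add: matrix_mul_assoc matrix_inv_works[OF invertible_resolvent[OF z]])
  qed
  have contN: "continuous_on (sphere 0 1) N"
    unfolding N_def X_def by (intro continuous_intros contU)
  have N_ker: "v = 0" if z: "z \<in> sphere 0 1" and "N z *v v = 0" for z v
  proof -
    have "X z *v v = 0" using that GN[OF z] by (metis matrix_vector_mul_assoc matrix_vector_mult_0_right)
    then have "mat z *v (X z *v v) = 0" by simp
    then have "U z *v (B *v v) = 0"
      using z complex_norm_square[of z] by (simp add: X_def matrix_vector_mul_assoc matrix_mul_assoc mat_mult_mat)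
    then have "(mat 1 - mat (cnj z) ** F) *v (U z *v (B *v v)) = 0" by simp
    then have "B *v v = 0" by (simp add: matrix_vector_mul_assoc matrix_mul_assoc U(2)[OF z])
    then show ?thesis by (rule B_ker)
  qed
  have "\<Phi> \<in> S_plus"
  proof (rule continuous_pos_def_in_S_plus)
    show "continuous_on (sphere 0 1) \<Phi>"
      unfolding \<Phi>_def by (intro continuous_intros contN)
    fix z :: complex assume z: "z \<in> sphere 0 1"
    have "invertible (N z)" using N_ker[OF z] by (auto simp: invertible_ker)
    then have "invertible (ctrans (N z))" by (rule invertible_ctrans)
    then show "pos_def (\<Phi> z)"
      using pos_def_congruence[OF pos_def_matrix_inv[OF pos_def_S], of "ctrans (N z)"]
      by (auto simp: \<Phi>_def invertible_ker)
  qed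
  moreover have "Gam A B \<Phi> = mat 1"
  proof -
    have "G z ** \<Phi> z ** ctrans (G z) = U z + ctrans (U z) - mat 1" if z: "z \<in> sphere 0 1" for z
    proof -
      have "G z ** \<Phi> z ** ctrans (G z) = (G z ** N z) ** matrix_inv S ** ctrans (G z ** N z)"
        by (simp add: \<Phi>_def ctrans_mult matrix_mul_assoc)
      also have "\<dots> = (mat (cnj z) ** (U z ** B)) ** matrix_inv S ** ctrans (mat (cnj z) ** (U z ** B))"
        unfolding GN[OF z] by (simp add: X_def matrix_mul_assoc)
      also have "\<dots> = (U z ** B) ** matrix_inv S ** ctrans (U z ** B)"
        by (rule congruence_unimodular) (use z in simp)
      also have "\<dots> = U z ** Pi_proj B ** ctrans (U z)"
        by (simp add: Pi_proj_def ctrans_mult matrix_mul_assoc)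
      also have "\<dots> = U z ** (mat 1 - F ** ctrans F) ** ctrans (U z)"
        by (simp add: FF)
      also have "\<dots> = U z ** ctrans (U z) - (U z ** F) ** mat 1 ** ctrans (U z ** F)"
        by (simp add: mm.diff_left mm.diff_right ctrans_mult matrix_mul_assoc)
      also have "\<dots> = U z ** ctrans (U z)
          - (mat (cnj z) ** (U z ** F)) ** mat 1 ** ctrans (mat (cnj z) ** (U z ** F))"
        by (subst congruence_unimodular) (use z in auto)
      also have "mat (cnj z) ** (U z ** F) = U z - mat 1"
        using U(1)[OF z] by (simp add: mm.diff_right matrix_mul_assoc mat_commute[of _ "U z"] algebra_simps)
      finally show ?thesis
        by (simp add: ctrans_diff mm.diff_left mm.diff_right)
    qed
    then have "Gam A B \<Phi> = circle_integral (\<lambda>z. U z + ctrans (U z) - mat 1)"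
      unfolding Gam_def by (rule circle_integral_cong)
    also have "\<dots> = circle_integral U + circle_integral (\<lambda>z. ctrans (U z)) - mat 1"
      by (subst circle_integral_diff circle_integral_add;
          (intro integrable_circ_continuous continuous_intros contU)?)+ simp
    finally show ?thesis
      by (simp add: intU) (simp add: U_def intT)
  qed
  ultimately show ?thesis by (auto simp: feasible_def)
qed

end

section \<open>The rank condition\<close>

definition join_vec :: "complex^'n \<Rightarrow> complex^'m \<Rightarrow> complex^('n + 'm)"
  where "join_vec u s = (\<chi> i. case i of Inl k \<Rightarrow> u $ k | Inr k \<Rightarrow> s $ k)"

lemma join_vec_nth [simp]: "join_vec u s $ Inl k = u $ k" "join_vec u s $ Inr l = s $ l"
  by (simp_all add: join_vec_def)

lemma join_vec_eq_iff [simp]: "join_vec u s = join_vec u' s' \<longleftrightarrow> u = u' \<and> s = s'"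
proof
  assume "join_vec u s = join_vec u' s'"
  then have "join_vec u s $ Inl k = join_vec u' s' $ Inl k" "join_vec u s $ Inr l = join_vec u' s' $ Inr l" for k l
    by simp_all
  then show "u = u' \<and> s = s'" by (simp add: vec_eq_iff)
qed simp

lemma join_vec_surj: obtains u s where "w = join_vec u s"
proof
  show "w = join_vec (\<chi> k. w $ Inl k) (\<chi> l. w $ Inr l)"
    by (simp add: vec_eq_iff join_vec_def split: sum.split)
qed

lemma span_rows: "vec.span (rows M) = range (\<lambda>x. x v* M)" for M :: "complex^'a^'b"
proof -
  have "rows M = (\<lambda>x. transpose M *v x) ` cart_basis"
  proof -
    have 1: "transpose M *v axis i 1 = row i M" for i
      by (simp add: matrix_vector_mult_axis vec_eq_iff row_def transpose_def del: transpose_matrix_vector)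
    have 2: "rows M = range (\<lambda>i. row i M)" by (auto simp: rows_def)
    have 3: "(cart_basis :: (complex^'b) set) = range (\<lambda>i. axis i 1)"
      by (auto simp: cart_basis_def)
    show ?thesis by (simp only: 1 2 3 image_image)
  qed
  then have "vec.span (rows M) = (\<lambda>x. transpose M *v x) ` vec.span cart_basis"
    using vec.span_image[of "transpose M" cart_basis] by simp
  then show ?thesis by simp
qed

lemma vector_matrix_zero:
  fixes M :: "complex^'a^'b"
  assumes "\<And>x. x v* M = 0"
  shows "M = 0"
proof -
  have "transpose M *v x = 0 *v x" for x using assms by simp
  then have "transpose M = 0" using matrix_eq by blast
  then show ?thesis by (simp add: vec_eq_iff transpose_def)
qed

lemma join_vec_block_matrix:
  "join_vec x y v* block_matrix A B
    = join_vec (x v* (mat 1 - A ** ctrans A) + y v* ctrans B) (x v* B)"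
proof -
  have s: "(\<Sum>i\<in>UNIV. f i) = (\<Sum>k\<in>UNIV. f (Inl k)) + (\<Sum>l\<in>UNIV. f (Inr l))"
    for f :: "'a::finite + 'b::finite \<Rightarrow> complex"
    unfolding UNIV_Plus_UNIV[symmetric] by (subst sum.Plus) auto
  show ?thesis
    unfolding vec_eq_iff
  proof
    fix i :: "'a + 'b"
    show "(join_vec x y v* block_matrix A B) $ i
      = join_vec (x v* (mat 1 - A ** ctrans A) + y v* ctrans B) (x v* B) $ i"
      by (cases i) (simp_all add: s vector_matrix_mult_def block_matrix_def)
  qed
qed

lemma (in stable_filter) row_ker:
  assumes "y v* ctrans B = 0"
  shows "y = 0"
proof -
  have "y v* (S ** matrix_inv S) = 0"
  proof -
    have "y v* (S ** matrix_inv S) = y v* ctrans B v* B v* matrix_inv S"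
      by (simp add: vector_matrix_mul_assoc matrix_mul_assoc)
    then show ?thesis by (simp add: assms)
  qed
  then show ?thesis by (simp add: S_inv)
qed

text \<open>The row space of the block matrix always contains the rows coming from \<open>x\<close> in the span of the
  rows of \<open>B\<^sup>*\<close>, a space parametrized injectively by \<open>2m\<close> coordinates. So the rank is \<open>2m\<close> exactly
  when these rows are all of them, and the remaining ones, for \<open>x\<close> with \<open>x B = 0\<close>, belong to it iff the
  compression of $I - AA^*$ to the orthogonal complement of the range of \<open>B\<close> vanishes.\<close>

lemma (in stable_filter) rank_block_matrix_iff:
  "rank (block_matrix A B) = 2 * CARD('m) \<longleftrightarrow> C ** (mat 1 - A ** ctrans A) ** C = 0"
proof -
  define M where "M = mat 1 - A ** ctrans A"
  define W where "W = range (\<lambda>w. w v* block_matrix A B)"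
  have W: "W = {join_vec (x v* M + y v* ctrans B) (x v* B) | x y. True}"
  proof (intro subset_antisym subsetI)
    fix v assume "v \<in> W"
    then obtain w where w: "v = w v* block_matrix A B" unfolding W_def by blast
    obtain x y where "w = join_vec x y" by (rule join_vec_surj)
    then show "v \<in> {join_vec (x v* M + y v* ctrans B) (x v* B) | x y. True}"
      using w by (auto simp: join_vec_block_matrix M_def)
  next
    fix v assume "v \<in> {join_vec (x v* M + y v* ctrans B) (x v* B) | x y. True}"
    then show "v \<in> W" unfolding W_def by (auto simp: join_vec_block_matrix[symmetric] M_def)
  qed
  define h :: "complex^('m + 'm) \<Rightarrow> complex^('n + 'm)"
    where "h = (\<lambda>w. join_vec ((\<chi> k. w $ Inl k) v* ctrans B) (\<chi> l. w $ Inr l) v* block_matrix A B)"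
  have h: "h (join_vec u y) = join_vec (u v* (ctrans B ** M) + y v* ctrans B) (u v* S)" for u y
    by (simp add: h_def join_vec_block_matrix M_def vector_matrix_mul_assoc)
  have lin: "Vector_Spaces.linear (*s) (*s) h"
  proof -
    let ?j = "\<lambda>w :: complex^('m + 'm). join_vec ((\<chi> k. w $ Inl k) v* ctrans B) (\<chi> l. w $ Inr l)"
    have "?j (v + w) = ?j v + ?j w" "?j (c *s v) = c *s ?j v" for v w c
      by (simp_all add: vec_eq_iff join_vec_def vector_matrix_mult_def algebra_simps sum.distrib
          sum_distrib_left split: sum.split)
    then show ?thesis
      unfolding h_def Vector_Spaces.linear_iff by (simp add: vec.vector_space_axioms vector_matrix_left_distrib scalar_vector_matrix_assoc)
  qed
  have inj: "inj h"
  proof -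
    have "w = 0" if "h w = 0" for w
    proof -
      obtain u y where w: "w = join_vec u y" by (rule join_vec_surj)
      have z: "(0 :: complex^('n+'m)) = join_vec 0 0" by (simp add: vec_eq_iff join_vec_def split: sum.split)
      have "u v* S = 0" and y: "u v* (ctrans B ** M) + y v* ctrans B = 0"
        using that unfolding w h z by auto
      then have "u v* S v* matrix_inv S = 0" by simp
      then have u: "u = 0" by (simp add: vector_matrix_mul_assoc S_inv)
      then have "y = 0" using y row_ker by simp
      then show ?thesis using u by (simp add: w vec_eq_iff join_vec_def split: sum.split)
    qed
    then show ?thesis using vec.linear_inj_iff_eq_0[OF lin] by blast
  qed
  have dim_h: "vec.dim (range h) = 2 * CARD('m)"
    using vec.dim_image_eq[OF lin, of UNIV] inj by (simp add: card_cart_basis mult_2)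
  have sub: "range h \<subseteq> W" unfolding h_def W_def by blast
  have sW: "vec.subspace W" "vec.subspace (range h)"
  proof -
    show "vec.subspace W" unfolding W_def span_rows[symmetric] by (rule vec.subspace_span)
    show "vec.subspace (range h)"
      by (rule vec.linear_subspace_image[OF lin vec.subspace_UNIV])
  qed
  have "rank (block_matrix A B) = vec.dim W"
    unfolding row_rank_def_gen W_def span_rows[symmetric] by (simp add: vec.dim_span)
  then have "rank (block_matrix A B) = 2 * CARD('m) \<longleftrightarrow> W = range h"
    using vec.subspace_dim_equal[OF sW(2,1) sub] dim_h by auto
  also have "\<dots> \<longleftrightarrow> C ** M ** C = 0"
  proof
    assume eq: "W = range h"
    have "x v* (C ** M ** C) = 0" for x
    proof -
      have "join_vec (x v* C v* M + 0 v* ctrans B) (x v* C v* B) \<in> W" unfolding W by blast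
      then obtain w where "join_vec (x v* (C ** M)) (x v* (C ** B)) = h w"
        unfolding eq by (auto simp: vector_matrix_mul_assoc)
      moreover obtain u y where "w = join_vec u y" by (rule join_vec_surj)
      ultimately have e: "x v* (C ** M) = u v* (ctrans B ** M) + y v* ctrans B" and "u v* S = 0"
        by (auto simp: h C_B)
      then have "u v* S v* matrix_inv S = 0" by simp
      then have "u = 0" by (simp add: vector_matrix_mul_assoc S_inv)
      with e have "x v* (C ** M) v* C = y v* ctrans B v* C" by simp
      also have "\<dots> = 0" by (simp only: vector_matrix_mul_assoc B_C vector_matrix_mult_0_right)
      finally show ?thesis by (simp only: vector_matrix_mul_assoc)
    qed
    then show "C ** M ** C = 0" by (rule vector_matrix_zero)
  next
    assume "C ** M ** C = 0"
    then have CM: "C ** M = C ** M ** Pi_proj B"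
      by (simp only: mm.diff_right matrix_mul_rid right_minus_eq)
    have "join_vec (x v* M + y v* ctrans B) (x v* B) \<in> range h" for x y
    proof -
      define u where "u = x v* (B ** matrix_inv S)"
      define y' where "y' = y + x v* (C ** M ** B ** matrix_inv S)"
      have "x v* M = x v* (Pi_proj B ** M) + x v* (C ** M)"
        by (simp only: vector_matrix_mult_add_rdistrib[symmetric] mm.add_left[symmetric]) simp
      also have "x v* (C ** M) = x v* (C ** M ** B ** matrix_inv S) v* ctrans B"
        by (subst CM) (simp add: Pi_proj_def vector_matrix_mul_assoc matrix_mul_assoc)
      also have "x v* (Pi_proj B ** M) = u v* (ctrans B ** M)"
        by (simp add: u_def Pi_proj_def vector_matrix_mul_assoc matrix_mul_assoc)
      finally have 1: "x v* M + y v* ctrans B = u v* (ctrans B ** M) + y' v* ctrans B"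
        by (simp add: y'_def vector_matrix_left_distrib)
      have "u v* S = x v* (B ** (matrix_inv S ** S))"
        by (simp only: u_def vector_matrix_mul_assoc matrix_mul_assoc)
      then have "u v* S = x v* B" by (simp add: S_inv)
      with 1 have "join_vec (x v* M + y v* ctrans B) (x v* B) = h (join_vec u y')"
        by (simp add: h)
      then show ?thesis by simp
    qed
    then have "W \<subseteq> range h" unfolding W by blast
    then show "W = range h" using sub by blast
  qed
  finally show ?thesis by (simp add: M_def)
qed

section \<open>Logarithmic divergence and convexity of the inverse\<close>

text \<open>The sign \<open>s\<close> lets one antiderivative serve on either side of \<open>t0\<close>.\<close>

lemma has_integral_reciprocal_affine_abs:
  fixes \<epsilon> L s a b t0 :: real
  assumes "0 < \<epsilon>" "0 < L" "\<bar>s\<bar> = 1" "a \<le> b" and sgn: "\<And>t. t \<in> {a..b} \<Longrightarrow> \<bar>t - t0\<bar> = s * (t - t0)"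
  shows "((\<lambda>t. 1 / (\<epsilon> + L * \<bar>t - t0\<bar>)) has_integral
    (s * ln (\<epsilon> + L * (s * (b - t0))) / L - s * ln (\<epsilon> + L * (s * (a - t0))) / L)) {a..b}"
proof (rule fundamental_theorem_of_calculus[OF \<open>a \<le> b\<close>])
  fix t assume t: "t \<in> {a..b}"
  have pos: "0 < \<epsilon> + L * (s * (t - t0))"
    using assms(1,2) sgn[OF t] by (metis abs_ge_zero add_pos_nonneg less_eq_real_def mult_nonneg_nonneg)
  have ss: "s * s = 1" using assms(3) by (metis abs_mult_self_eq mult_1)
  have "((\<lambda>t. s * ln (\<epsilon> + L * (s * (t - t0))) / L) has_real_derivative
      s * ((L * s) / (\<epsilon> + L * (s * (t - t0)))) / L) (at t within {a..b})"
    using pos by (auto intro!: derivative_eq_intros)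
  also have "s * ((L * s) / (\<epsilon> + L * (s * (t - t0)))) / L = 1 / (\<epsilon> + L * \<bar>t - t0\<bar>)"
    using assms(2) ss sgn[OF t] by simp
  finally show "((\<lambda>t. s * ln (\<epsilon> + L * (s * (t - t0))) / L) has_vector_derivative
      1 / (\<epsilon> + L * \<bar>t - t0\<bar>)) (at t within {a..b})"
    by (simp add: has_real_derivative_iff_has_vector_derivative)
qed

text \<open>One of the two intervals of length $\pi$ with end point $\theta_0$ lies inside $[-\pi,\pi]$.
  The logarithm, unbounded as $\varepsilon \to 0$, is what keeps minimizing sequences away from the boundary
  of the domain.\<close>

lemma integral_reciprocal_ge_ln:
  fixes \<epsilon> L \<theta>0 :: real
  assumes \<epsilon>: "0 < \<epsilon>" and L: "0 < L" and \<theta>0: "\<theta>0 \<in> {-pi..pi}"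
  shows "ln (1 + L * pi / \<epsilon>) / L \<le> (LINT \<theta>|circ. 1 / (\<epsilon> + L * \<bar>\<theta> - \<theta>0\<bar>))"
proof -
  let ?f = "\<lambda>\<theta>. 1 / (\<epsilon> + L * \<bar>\<theta> - \<theta>0\<bar>)"
  have pos: "0 < \<epsilon> + L * \<bar>\<theta> - \<theta>0\<bar>" for \<theta>
    using \<epsilon> L by (simp add: add_pos_nonneg)
  have cont: "continuous_on X ?f" for X
    using pos by (intro continuous_intros) (metis less_irrefl)
  have ln_eq: "ln (\<epsilon> + L * pi) / L - ln \<epsilon> / L = ln (1 + L * pi / \<epsilon>) / L"
  proof -
    have "ln (1 + L * pi / \<epsilon>) = ln ((\<epsilon> + L * pi) / \<epsilon>)" using \<epsilon> by (simp add: field_simps)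
    also have "\<dots> = ln (\<epsilon> + L * pi) - ln \<epsilon>" using \<epsilon> add_pos_pos[OF \<epsilon> mult_pos_pos[OF L pi_gt_zero]] by (simp add: ln_div)
    finally show ?thesis by (simp add: diff_divide_distrib)
  qed
  have "\<exists>a b. {a..b} \<subseteq> {-pi..pi} \<and> (?f has_integral (ln (\<epsilon> + L * pi) / L - ln \<epsilon> / L)) {a..b}"
  proof (cases "\<theta>0 \<le> 0")
    case True
    have "(?f has_integral (1 * ln (\<epsilon> + L * (1 * (\<theta>0 + pi - \<theta>0))) / L
        - 1 * ln (\<epsilon> + L * (1 * (\<theta>0 - \<theta>0))) / L)) {\<theta>0..\<theta>0 + pi}"
      by (rule has_integral_reciprocal_affine_abs[OF \<epsilon> L]) auto
    then show ?thesis using True \<theta>0 by (intro exI[of _ \<theta>0] exI[of _ "\<theta>0 + pi"]) auto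
  next
    case False
    have "(?f has_integral (-1 * ln (\<epsilon> + L * (-1 * (\<theta>0 - \<theta>0))) / L
        - -1 * ln (\<epsilon> + L * (-1 * (\<theta>0 - pi - \<theta>0))) / L)) {\<theta>0 - pi..\<theta>0}"
      by (rule has_integral_reciprocal_affine_abs[OF \<epsilon> L]) auto
    then show ?thesis using False \<theta>0 by (intro exI[of _ "\<theta>0 - pi"] exI[of _ "\<theta>0"]) auto
  qed
  then obtain a b where ab: "{a..b} \<subseteq> {-pi..pi}"
    and int: "(?f has_integral (ln (1 + L * pi / \<epsilon>) / L)) {a..b}"
    unfolding ln_eq by blast
  have "?f integrable_on {-pi..pi}" by (rule integrable_continuous_real[OF cont])
  then have "ln (1 + L * pi / \<epsilon>) / L \<le> integral {-pi..pi} ?f"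
    using has_integral_subset_le[OF ab int integrable_integral] pos by (simp add: less_eq_real_def)
  also have "\<dots> = (LINT \<theta>|circ. ?f \<theta>)"
    by (rule lebesgue_integral_eq_integral[symmetric])
       (auto intro: continuous_imp_integrable_real cont)
  finally show ?thesis .
qed

text \<open>The resolvent identity $Q^{-1} = M^{-1} - M^{-1}(Q-M)Q^{-1}$, used once from each side, gives an exact
  second order expansion of the inverse at \<open>M\<close>.\<close>

lemma inverse_expansion:
  fixes M Q :: "complex^'a^'a"
  assumes "M ** Y = mat 1" "Y ** M = mat 1" "Q ** X = mat 1" "X ** Q = mat 1"
  shows "X = Y - Y ** (Q - M) ** Y + Y ** (Q - M) ** X ** (Q - M) ** Y"
proof -
  have 1: "Y ** (Q - M) ** X = Y - X"
    by (simp add: mm.diff_left mm.diff_right assms flip: matrix_mul_assoc)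
  have 2: "X ** (Q - M) ** Y = Y - X"
    by (simp add: mm.diff_left mm.diff_right assms flip: matrix_mul_assoc)
  have "Y ** (Q - M) ** X ** (Q - M) ** Y = Y ** (Q - M) ** (X ** (Q - M) ** Y)"
    by (simp add: matrix_mul_assoc)
  also have "\<dots> = Y ** (Q - M) ** Y - Y ** (Q - M) ** X"
    by (simp only: 2 mm.diff_right[of _ Y X])
  finally show ?thesis by (simp add: 1)
qed

lemma pos_def_midpoint:
  assumes "pos_def M" "pos_def N"
  shows "pos_def ((1/2) *\<^sub>R (M + N))"
  using assms unfolding pos_def_def herm_def
  by (auto simp: ctrans_scaleR ctrans_add bounded_bilinear.scaleR_left[OF bounded_bilinear_matrix_vector_mult]
      matrix_vector_mult_add_rdistrib inner_add_right intro!: add_pos_pos)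

text \<open>At the midpoint the first order terms of the two expansions cancel:
  $\frac12(Q_1^{-1}+Q_2^{-1}) - M^{-1} = \frac12\sum_i M^{-1} D\, Q_i^{-1} D M^{-1}$. Both terms on the right
  are non-negative; keeping the first is enough to detect \<open>D \<noteq> 0\<close>.\<close>

lemma trace_inverse_midpoint:
  fixes Q1 Q2 \<Psi> :: "complex^'a^'a"
  assumes Q: "pos_def Q1" "pos_def Q2" and c: "0 \<le> c" "nonneg_def (\<Psi> - mat (of_real c))"
  defines "M \<equiv> (1/2) *\<^sub>R (Q1 + Q2)" and "D \<equiv> (1/2) *\<^sub>R (Q1 - Q2)"
  shows "Re (trace (matrix_inv M ** \<Psi>))
      + c / 2 * Re (trace (ctrans (D ** matrix_inv M) ** matrix_inv Q1 ** (D ** matrix_inv M)))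
    \<le> (Re (trace (matrix_inv Q1 ** \<Psi>)) + Re (trace (matrix_inv Q2 ** \<Psi>))) / 2"
proof -
  have M: "pos_def M"
    unfolding M_def by (rule pos_def_midpoint[OF Q])
  let ?Y = "matrix_inv M" and ?X1 = "matrix_inv Q1" and ?X2 = "matrix_inv Q2"
  note inv = matrix_inv_works[OF pos_def_imp_invertible]
  have D1: "Q1 - M = D" and D2: "Q2 - M = - D"
    by (simp_all add: M_def D_def vec_eq_iff) (simp_all add: scaleR_conv_of_real field_simps)
  let ?E = "\<lambda>X. ?Y ** D ** X ** D ** ?Y"
  have e1: "?X1 = ?Y - ?Y ** D ** ?Y + ?E ?X1"
    using inverse_expansion[OF inv[OF M] inv[OF Q(1)]] by (simp only: D1)
  have e2: "?X2 = ?Y + ?Y ** D ** ?Y + ?E ?X2"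
    using inverse_expansion[OF inv[OF M] inv[OF Q(2)]] by (simp add: D2 mm.minus_left mm.minus_right)
  have sum: "?X1 + ?X2 = ?Y + ?Y + (?E ?X1 + ?E ?X2)"
    by (subst e1, subst e2) simp
  have hD: "ctrans D = D"
    using Q by (simp add: D_def ctrans_scaleR ctrans_diff pos_def_def herm_def)
  have hY: "ctrans ?Y = ?Y" using pos_def_matrix_inv[OF M] by (simp add: pos_def_def herm_def)
  have E: "?E X = ctrans (D ** ?Y) ** X ** (D ** ?Y)" for X
    by (simp add: ctrans_mult hD hY matrix_mul_assoc)
  have nE: "nonneg_def (?E ?X1)" "nonneg_def (?E ?X2)"
    unfolding E
    by (rule nonneg_def_congruence[OF pos_def_imp_nonneg_def[OF pos_def_matrix_inv[OF Q(1)]]]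
        nonneg_def_congruence[OF pos_def_imp_nonneg_def[OF pos_def_matrix_inv[OF Q(2)]]])+
  have "Re (trace ((?X1 + ?X2) ** \<Psi>)) = 2 * Re (trace (?Y ** \<Psi>)) + Re (trace (\<Psi> ** ?E ?X1)) + Re (trace (\<Psi> ** ?E ?X2))"
    unfolding sum by (simp only: mm.add_left trace_add trace_mul_sym[of _ \<Psi>]) simp
  moreover have "c * Re (trace (?E ?X1)) \<le> Re (trace (\<Psi> ** ?E ?X1))"
    "c * Re (trace (?E ?X2)) \<le> Re (trace (\<Psi> ** ?E ?X2))"
    using nonneg_def_mat_diff_trace[OF c(2)] nE by blast+
  moreover have "0 \<le> c * Re (trace (?E ?X2))"
    using c(1) Re_trace_nonneg[OF nE(2)] by simp
  ultimately show "Re (trace (matrix_inv M ** \<Psi>))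
      + c / 2 * Re (trace (ctrans (D ** matrix_inv M) ** matrix_inv Q1 ** (D ** matrix_inv M)))
    \<le> (Re (trace (matrix_inv Q1 ** \<Psi>)) + Re (trace (matrix_inv Q2 ** \<Psi>))) / 2"
    unfolding E[symmetric] by (simp add: mm.add_left trace_add)
qed

section \<open>Coercivity of the dual functional\<close>

context stable_filter
begin

definition Q :: "complex^'n^'n \<Rightarrow> complex \<Rightarrow> complex^'m^'m"
  where "Q \<Lambda> z = mat 1 + ctrans (G z) ** \<Lambda> ** G z"

lemma herm_Q: "herm \<Lambda> \<Longrightarrow> herm (Q \<Lambda> z)"
  using herm_congruence[of \<Lambda> "G z"] by (simp add: Q_def herm_def ctrans_add)

lemma L_H_iff: "\<Lambda> \<in> L_H A B \<longleftrightarrow> herm \<Lambda> \<and> (\<forall>z\<in>sphere 0 1. pos_def (Q \<Lambda> z))"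
  by (simp add: L_H_def Q_def)

lemma continuous_on_Q:
  assumes "continuous_on X f" "continuous_on X g" "g ` X \<subseteq> sphere 0 1"
  shows "continuous_on X (\<lambda>x. Q (f x) (g x))"
  unfolding Q_def
  by (intro continuous_intros assms(1) continuous_on_compose2[OF continuous_on_transfer assms(2,3)])

abbreviation V :: "(complex^'n^'n) set" where "V \<equiv> Gam A B ` C_herm"

lemma Gam_add:
  assumes "\<Phi> \<in> C_herm" "\<Phi>' \<in> C_herm"
  shows "Gam A B (\<lambda>z. \<Phi> z + \<Phi>' z) = Gam A B \<Phi> + Gam A B \<Phi>'"
  using circle_integral_add[OF integrable_Gam[OF C_herm_measurable_bounded[OF assms(1)]] integrable_Gam[OF C_herm_measurable_bounded[OF assms(2)]]]
  by (simp add: Gam_def mm.add_left mm.add_right)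

lemma Gam_scaleR: "Gam A B (\<lambda>z. c *\<^sub>R \<Phi> z) = c *\<^sub>R Gam A B \<Phi>"
  by (simp add: Gam_def mm.scaleR_left mm.scaleR_right circle_integral_scaleR)

lemma subspace_V: "subspace V"
proof (rule subspaceI)
  have z: "(\<lambda>z. 0 :: complex^'m^'m) \<in> C_herm" by (simp add: C_herm_def herm_def vec_eq_iff)
  have "0 = Gam A B (\<lambda>z. 0)" using Gam_scaleR[of 0 "\<lambda>z. 0"] by simp
  then show "0 \<in> V" by (rule image_eqI[OF _ z])
next
  fix x y assume "x \<in> V" "y \<in> V"
  then obtain \<Phi> \<Phi>' where \<Phi>: "\<Phi> \<in> C_herm" "\<Phi>' \<in> C_herm" "x = Gam A B \<Phi>" "y = Gam A B \<Phi>'" by blast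
  then have m: "(\<lambda>z. \<Phi> z + \<Phi>' z) \<in> C_herm"
    by (auto simp: C_herm_def herm_def ctrans_add intro!: continuous_intros)
  show "x + y \<in> V"
    by (rule image_eqI[OF _ m]) (simp add: Gam_add[OF \<Phi>(1,2)] \<Phi>(3,4))
next
  fix c x assume "x \<in> V"
  then obtain \<Phi> where \<Phi>: "\<Phi> \<in> C_herm" "x = Gam A B \<Phi>" by blast
  then have m: "(\<lambda>z. c *\<^sub>R \<Phi> z) \<in> C_herm"
    by (auto simp: C_herm_def herm_def ctrans_scaleR intro!: continuous_intros)
  show "c *\<^sub>R x \<in> V"
    by (rule image_eqI[OF _ m]) (simp add: Gam_scaleR \<Phi>(2))
qed

lemma herm_V:
  assumes "x \<in> V"
  shows "herm x"
proof -
  obtain \<Phi> where \<Phi>: "\<Phi> \<in> C_herm" "x = Gam A B \<Phi>" using assms by blast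
  have "ctrans x = circle_integral (\<lambda>z. ctrans (G z ** \<Phi> z ** ctrans (G z)))"
    unfolding \<Phi>(2) Gam_def
    by (rule circle_integral_bounded_linear[OF bounded_linear_ctrans integrable_Gam[OF C_herm_measurable_bounded[OF \<Phi>(1)]]])
  also have "\<dots> = x"
    unfolding \<Phi>(2) Gam_def using \<Phi>(1)
    by (intro circle_integral_cong) (simp add: C_herm_def herm_def ctrans_mult matrix_mul_assoc)
  finally show ?thesis by (simp add: herm_def)
qed

lemma L_Gam_iff: "\<Lambda> \<in> L_Gam A B \<longleftrightarrow> \<Lambda> \<in> V \<and> (\<forall>z\<in>sphere 0 1. pos_def (Q \<Lambda> z))"
  using herm_V by (auto simp: L_Gam_def L_H_iff)

text \<open>The map \<open>\<Lambda> \<mapsto> G\<^sup>* \<Lambda> G\<close> is the adjoint of \<open>Gam\<close> for the trace inner product.\<close>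

lemma trace_Gam:
  assumes "(\<lambda>\<theta>. \<Phi> (cis \<theta>)) \<in> borel_measurable circ" "bounded (\<Phi> ` sphere 0 1)"
  shows "Re (trace (\<Lambda> ** Gam A B \<Phi>)) = circle_integral (\<lambda>z. Re (trace (\<Phi> z ** (Q \<Lambda> z - mat 1))))"
proof -
  have e: "trace (\<Lambda> ** (G z ** \<Phi> z ** ctrans (G z))) = trace (\<Phi> z ** (Q \<Lambda> z - mat 1))" for z
  proof -
    have "trace (\<Lambda> ** (G z ** \<Phi> z ** ctrans (G z))) = trace (\<Lambda> ** G z ** (\<Phi> z ** ctrans (G z)))"
      by (simp add: matrix_mul_assoc)
    also have "\<dots> = trace (\<Phi> z ** ctrans (G z) ** (\<Lambda> ** G z))" by (rule trace_mul_sym)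
    finally show ?thesis by (simp add: Q_def matrix_mul_assoc)
  qed
  show ?thesis
    unfolding Gam_def e[symmetric]
    by (rule circle_integral_bounded_linear[OF bounded_linear_Re_trace_mult integrable_Gam[OF assms]])
qed

lemma continuous_on_Q_circle: "continuous_on (sphere 0 1) (Q \<Lambda>)"
  by (rule continuous_on_Q) (auto intro!: continuous_intros)

lemma continuous_on_inv_Q:
  assumes "\<Lambda> \<in> L_H A B"
  shows "continuous_on (sphere 0 1) (\<lambda>z. matrix_inv (Q \<Lambda> z))"
  using assms by (intro continuous_on_matrix_inv continuous_on_Q_circle) (auto simp: L_H_iff pos_def_imp_invertible)

end

locale feasible_dual_problem = stable_filter A B
  for A :: "complex^'n^'n" and B :: "complex^'m^'n" +
  fixes \<Psi> :: "complex \<Rightarrow> complex^'m^'m"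
  assumes Psi: "\<Psi> \<in> S_plus" and feasible: "feasible A B"
begin

abbreviation J :: "complex^'n^'n \<Rightarrow> real" where "J \<equiv> J_dual A B \<Psi>"

definition J_integral :: "complex^'n^'n \<Rightarrow> real"
  where "J_integral \<Lambda> = circle_integral (\<lambda>z. Re (trace (matrix_inv (Q \<Lambda> z) ** \<Psi> z)))"

lemma J_eq:
  assumes "\<Lambda> \<in> L_H A B"
  shows "J \<Lambda> = J_integral \<Lambda> + Re (trace \<Lambda>)"
proof -
  have "integrable_circle (\<lambda>z. matrix_inv (Q \<Lambda> z) ** \<Psi> z ** mat 1)"
    by (rule integrable_measurable_symbol[OF S_plusD(1,2)[OF Psi] continuous_on_inv_Q[OF assms]]) simp
  then have "integrable_circle (\<lambda>z. matrix_inv (Q \<Lambda> z) ** \<Psi> z)" by simp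
  from circle_integral_bounded_linear[OF bounded_linear_compose[OF bounded_linear_Re bounded_linear_trace] this]
  show ?thesis by (simp add: J_dual_def J_integral_def Q_def)
qed

lemma nonneg_Q: "\<Lambda> \<in> L_H A B \<Longrightarrow> z \<in> sphere 0 1 \<Longrightarrow> nonneg_def (Q \<Lambda> z)"
  by (simp add: L_H_iff pos_def_imp_nonneg_def)

lemma nonneg_inv_Q: "\<Lambda> \<in> L_H A B \<Longrightarrow> z \<in> sphere 0 1 \<Longrightarrow> nonneg_def (matrix_inv (Q \<Lambda> z))"
  by (simp add: L_H_iff pos_def_imp_nonneg_def pos_def_matrix_inv)

text \<open>With a feasible \<open>\<Phi>\<close>, $\mathrm{tr}\,\Lambda = \mathrm{tr}\,\Lambda\int G\Phi G^* = \int \mathrm{tr}\,\Phi(Q_\Lambda - I)$,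
  so the linear part of the functional controls $\int \mathrm{tr}\,Q_\Lambda$.\<close>

lemma trace_multiplier_ge:
  obtains c k where "0 < c"
    "\<forall>\<Lambda>\<in>L_H A B. c * circle_integral (\<lambda>z. Re (trace (Q \<Lambda> z))) - k \<le> Re (trace \<Lambda>)"
proof -
  obtain \<Phi> where \<Phi>: "\<Phi> \<in> S_plus" "Gam A B \<Phi> = mat 1" using feasible by (auto simp: feasible_def)
  note m = S_plusD(1,2)[OF \<Phi>(1)]
  obtain c where c: "0 < c" "\<forall>R. (\<forall>z\<in>sphere 0 1. nonneg_def (R z)) \<longrightarrow> continuous_on (sphere 0 1) R \<longrightarrow>
      c * circle_integral (\<lambda>z. Re (trace (R z))) \<le> circle_integral (\<lambda>z. Re (trace (\<Phi> z ** R z)))"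
    using S_plus_trace_ge[OF \<Phi>(1)] by blast
  define k where "k = circle_integral (\<lambda>z. Re (trace (\<Phi> z ** mat 1)))"
  have "c * circle_integral (\<lambda>z. Re (trace (Q \<Lambda> z))) - k \<le> Re (trace \<Lambda>)" if \<Lambda>: "\<Lambda> \<in> L_H A B" for \<Lambda>
  proof -
    have "Re (trace \<Lambda>) = circle_integral (\<lambda>z. Re (trace (\<Phi> z ** (Q \<Lambda> z - mat 1))))"
      using trace_Gam[OF m, of \<Lambda>] by (simp add: \<Phi>(2))
    also have "\<dots> = circle_integral (\<lambda>z. Re (trace (\<Phi> z ** Q \<Lambda> z)) - Re (trace (\<Phi> z ** mat 1)))"
      by (simp only: mm.diff_right trace_sub minus_complex.sel)
    also have "\<dots> = circle_integral (\<lambda>z. Re (trace (\<Phi> z ** Q \<Lambda> z))) - k"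
      unfolding k_def
      by (intro circle_integral_diff integrable_trace m continuous_on_Q_circle continuous_on_const)
    finally show ?thesis using c(2)[rule_format, OF nonneg_Q[OF \<Lambda>] continuous_on_Q_circle] by simp
  qed
  then show thesis using that c(1) by blast
qed

lemma J_integral_ge:
  obtains c where "0 < c"
    "\<forall>\<Lambda>\<in>L_H A B. c * circle_integral (\<lambda>z. Re (trace (matrix_inv (Q \<Lambda> z)))) \<le> J_integral \<Lambda>"
proof -
  obtain c where c: "0 < c" "\<forall>R. (\<forall>z\<in>sphere 0 1. nonneg_def (R z)) \<longrightarrow> continuous_on (sphere 0 1) R \<longrightarrow>
      c * circle_integral (\<lambda>z. Re (trace (R z))) \<le> circle_integral (\<lambda>z. Re (trace (\<Psi> z ** R z)))"
    using S_plus_trace_ge[OF Psi] by blast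
  have "c * circle_integral (\<lambda>z. Re (trace (matrix_inv (Q \<Lambda> z)))) \<le> J_integral \<Lambda>" if \<Lambda>: "\<Lambda> \<in> L_H A B" for \<Lambda>
    using c(2)[rule_format, OF nonneg_inv_Q[OF \<Lambda>] continuous_on_inv_Q[OF \<Lambda>]]
    by (simp only: J_integral_def trace_mul_sym[of _ "\<Psi> _"])
  then show thesis using that c(1) by blast
qed

text \<open>Both parts of the functional are bounded below, so an upper bound on their sum bounds each of them.\<close>

lemma sublevel_integral_bounds:
  obtains T where "0 \<le> T" "\<forall>\<Lambda>\<in>L_H A B. J \<Lambda> \<le> a \<longrightarrow>
    circle_integral (\<lambda>z. Re (trace (Q \<Lambda> z))) \<le> T \<and>
    circle_integral (\<lambda>z. Re (trace (matrix_inv (Q \<Lambda> z)))) \<le> T"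
proof -
  obtain c k where c: "0 < c"
    "\<forall>\<Lambda>\<in>L_H A B. c * circle_integral (\<lambda>z. Re (trace (Q \<Lambda> z))) - k \<le> Re (trace \<Lambda>)"
    using trace_multiplier_ge by blast
  obtain d where d: "0 < d"
    "\<forall>\<Lambda>\<in>L_H A B. d * circle_integral (\<lambda>z. Re (trace (matrix_inv (Q \<Lambda> z)))) \<le> J_integral \<Lambda>"
    using J_integral_ge by blast
  define T where "T = max 0 (max ((a + k) / c) ((a + k) / d))"
  have "circle_integral (\<lambda>z. Re (trace (Q \<Lambda> z))) \<le> T \<and>
    circle_integral (\<lambda>z. Re (trace (matrix_inv (Q \<Lambda> z)))) \<le> T" if \<Lambda>: "\<Lambda> \<in> L_H A B" "J \<Lambda> \<le> a" for \<Lambda>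
  proof -
    let ?p = "circle_integral (\<lambda>z. Re (trace (Q \<Lambda> z)))"
    let ?q = "circle_integral (\<lambda>z. Re (trace (matrix_inv (Q \<Lambda> z))))"
    have "0 \<le> ?p" "0 \<le> ?q"
      by (auto intro!: circle_integral_nonneg Re_trace_nonneg nonneg_Q nonneg_inv_Q \<Lambda>(1))
    then have "0 \<le> c * ?p" "0 \<le> d * ?q" using c d by auto
    moreover have "d * ?q + (c * ?p - k) \<le> a"
      using c(2)[rule_format, OF \<Lambda>(1)] d(2)[rule_format, OF \<Lambda>(1)] \<Lambda>(2) J_eq[OF \<Lambda>(1)] by linarith
    ultimately have "c * ?p \<le> a + k" "d * ?q \<le> a + k" by linarith+
    then have "?p \<le> (a + k) / c" "?q \<le> (a + k) / d"
      using c(1) d(1) by (simp_all add: field_simps)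
    then show ?thesis by (auto simp: T_def)
  qed
  moreover have "0 \<le> T" by (simp add: T_def)
  ultimately show thesis using that by blast
qed

text \<open>An element of \<open>V\<close>, the range of $\Gamma$, is determined by its pairings with an orthonormal basis of \<open>V\<close>.
  Its pairing with $\Gamma(\Phi)$ is $\int\mathrm{tr}\,\Phi(Q_\Lambda - I)$, at most a constant times
  $1 + \int\mathrm{tr}\,Q_\Lambda$ because the norm of $Q_\Lambda$ is dominated by its trace.\<close>

lemma bounded_of_integral_bound:
  obtains r where "\<And>\<Lambda>. \<Lambda> \<in> L_Gam A B \<Longrightarrow> circle_integral (\<lambda>z. Re (trace (Q \<Lambda> z))) \<le> T \<Longrightarrow> norm \<Lambda> \<le> r"
proof -
  obtain Bs where Bs: "Bs \<subseteq> V" "pairwise orthogonal Bs" "\<And>b. b \<in> Bs \<Longrightarrow> norm b = 1"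
    "independent Bs" "card Bs = dim V" "span Bs = V"
    using orthonormal_basis_subspace[OF subspace_V] by blast
  have fin: "finite Bs" using Bs(4) independent_imp_finite by blast
  have "\<exists>k. \<forall>\<Lambda>\<in>L_Gam A B. circle_integral (\<lambda>z. Re (trace (Q \<Lambda> z))) \<le> T \<longrightarrow> \<bar>\<Lambda> \<bullet> b\<bar> \<le> k" if b: "b \<in> Bs" for b
  proof -
    obtain \<Phi> where \<Phi>: "\<Phi> \<in> C_herm" "b = Gam A B \<Phi>" using b Bs(1) by blast
    obtain K where K: "0 < K" "\<And>(X::complex^'m^'m) Y. \<bar>Re (trace (X ** Y))\<bar> \<le> K * norm X * norm Y"
      using Re_trace_mult_bound by blast
    obtain p where p: "0 < p" "\<And>z. z \<in> sphere 0 1 \<Longrightarrow> norm (\<Phi> z) \<le> p"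
      using continuous_sphere_bounded[of \<Phi>] \<Phi>(1) by (auto simp: C_herm_def)
    let ?m = "(real CARD('m))\<^sup>2" and ?e = "norm (mat 1 :: complex^'m^'m)"
    have "\<bar>\<Lambda> \<bullet> b\<bar> \<le> K * p * (?m * T + ?e)"
      if \<Lambda>: "\<Lambda> \<in> L_Gam A B" "circle_integral (\<lambda>z. Re (trace (Q \<Lambda> z))) \<le> T" for \<Lambda>
    proof -
      have LH: "\<Lambda> \<in> L_H A B" using \<Lambda>(1) by (simp add: L_Gam_def)
      let ?F = "\<lambda>z. Re (trace (\<Phi> z ** (Q \<Lambda> z - mat 1)))"
      let ?H = "\<lambda>z. K * p * (?m * Re (trace (Q \<Lambda> z)) + ?e)"
      have pw: "\<bar>?F z\<bar> \<le> ?H z" if z: "z \<in> sphere 0 1" for z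
      proof -
        have "\<bar>?F z\<bar> \<le> K * norm (\<Phi> z) * norm (Q \<Lambda> z - mat 1)" by (rule K)
        also have "\<dots> \<le> K * p * (?m * Re (trace (Q \<Lambda> z)) + ?e)"
        proof (intro mult_mono)
          have "norm (Q \<Lambda> z) \<le> ?m * Re (trace (Q \<Lambda> z))"
            using nonneg_def_norm_le[OF nonneg_Q[OF LH z]] by simp
          then show "norm (Q \<Lambda> z - mat 1) \<le> ?m * Re (trace (Q \<Lambda> z)) + ?e"
            using norm_triangle_ineq4[of "Q \<Lambda> z" "mat 1"] by linarith
        qed (use K p z in auto)
        finally show ?thesis .
      qed
      have pw1: "?F z \<le> ?H z" and pw2: "- ?F z \<le> ?H z" if "z \<in> sphere 0 1" for z
        using pw[OF that] by linarith+
      have contF: "continuous_on (sphere 0 1) ?F"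
        using \<Phi>(1) by (auto simp: C_herm_def intro!: continuous_intros continuous_on_Q_circle)
      have contH: "continuous_on (sphere 0 1) ?H"
        by (intro continuous_intros continuous_on_Q_circle)
      have "circle_integral ?F \<le> circle_integral ?H"
        by (rule circle_integral_mono_AE[OF integrable_circ_continuous[OF contF] integrable_circ_continuous[OF contH]])
           (intro AE_I2 pw1 cis_in_sphere)
      moreover have "circle_integral (\<lambda>z. - ?F z) \<le> circle_integral ?H"
        by (rule circle_integral_mono_AE[OF integrable_circ_continuous[OF continuous_on_minus[OF contF]]
              integrable_circ_continuous[OF contH]])
           (intro AE_I2 pw2 cis_in_sphere)
      moreover have "circle_integral (\<lambda>z. - ?F z) = - circle_integral ?F"
        using circle_integral_scaleR[of "-1" ?F] by simp
      moreover have "circle_integral ?H = K * p * (?m * circle_integral (\<lambda>z. Re (trace (Q \<Lambda> z))) + ?e)"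
      proof -
        have "circle_integral ?H = (K * p) *\<^sub>R circle_integral (\<lambda>z. ?m *\<^sub>R Re (trace (Q \<Lambda> z)) + ?e)"
          using circle_integral_scaleR[of "K * p" "\<lambda>z. ?m *\<^sub>R Re (trace (Q \<Lambda> z)) + ?e"] by simp
        also have "circle_integral (\<lambda>z. ?m *\<^sub>R Re (trace (Q \<Lambda> z)) + ?e)
            = circle_integral (\<lambda>z. ?m *\<^sub>R Re (trace (Q \<Lambda> z))) + circle_integral (\<lambda>z. ?e)"
          by (intro circle_integral_add integrable_circ_continuous continuous_intros continuous_on_Q_circle)
        finally show ?thesis
          using circle_integral_scaleR[of ?m "\<lambda>z. Re (trace (Q \<Lambda> z))"] by simp
      qed
      moreover have "K * p * (?m * circle_integral (\<lambda>z. Re (trace (Q \<Lambda> z))) + ?e) \<le> K * p * (?m * T + ?e)"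
        using \<Lambda>(2) K(1) p(1) by (intro mult_left_mono add_right_mono) auto
      ultimately have "\<bar>circle_integral ?F\<bar> \<le> K * p * (?m * T + ?e)" by linarith
      moreover have "\<Lambda> \<bullet> b = circle_integral ?F"
        using LH \<Phi>(2) trace_Gam[OF C_herm_measurable_bounded[OF \<Phi>(1)], of \<Lambda>] by (simp add: inner_herm_trace L_H_iff)
      ultimately show ?thesis by simp
    qed
    then show ?thesis by blast
  qed
  then obtain k where k: "\<And>b \<Lambda>. b \<in> Bs \<Longrightarrow> \<Lambda> \<in> L_Gam A B \<Longrightarrow>
      circle_integral (\<lambda>z. Re (trace (Q \<Lambda> z))) \<le> T \<Longrightarrow> \<bar>\<Lambda> \<bullet> b\<bar> \<le> k b"
    by metis
  have "norm \<Lambda> \<le> (\<Sum>b\<in>Bs. k b)"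
    if \<Lambda>: "\<Lambda> \<in> L_Gam A B" "circle_integral (\<lambda>z. Re (trace (Q \<Lambda> z))) \<le> T" for \<Lambda>
  proof -
    have "\<Lambda> \<in> span Bs" using \<Lambda>(1) by (simp add: Bs(6) L_Gam_iff)
    then have "norm \<Lambda> = norm (\<Sum>b\<in>Bs. (\<Lambda> \<bullet> b) *\<^sub>R b)"
      using orthonormal_basis_expand[OF Bs(2,3) _ fin] by simp
    also have "\<dots> \<le> (\<Sum>b\<in>Bs. k b)"
      by (rule sum_norm_le) (simp add: Bs(3) k[OF _ \<Lambda>])
    finally show ?thesis .
  qed
  then show thesis using that by blast
qed

end

section \<open>The barrier at the boundary of the domain\<close>

context stable_filter
begin

text \<open>From the resolvent identity $R(z) - R(w) = R(z)\,(w - z)\,R(w)$ and boundedness on the circle.\<close>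

lemma transfer_lipschitz:
  obtains L where "0 < L" "\<And>\<theta> \<theta>'. norm (G (cis \<theta>) - G (cis \<theta>')) \<le> L * \<bar>\<theta> - \<theta>'\<bar>"
proof -
  let ?R = "\<lambda>z. matrix_inv (mat z - A)"
  have cont: "continuous_on (sphere 0 1) ?R"
    by (intro continuous_intros continuous_on_matrix_inv invertible_resolvent)
  obtain p where p: "0 < p" "\<And>z. z \<in> sphere 0 1 \<Longrightarrow> norm (?R z) \<le> p"
    using continuous_sphere_bounded[OF cont] by blast
  obtain g where g: "0 < g" "\<And>z. z \<in> sphere 0 1 \<Longrightarrow> norm (G z) \<le> g"
    using continuous_sphere_bounded[OF continuous_on_transfer] by blast
  obtain K1 where K1: "0 < K1" "\<And>(X::complex^'n^'n) (Y::complex^'m^'n). norm (X ** Y) \<le> norm X * norm Y * K1"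
    using mm.pos_bounded by blast
  obtain K2 where K2: "0 < K2" "\<And>c. norm (mat c :: complex^'n^'n) \<le> norm c * K2"
    using bounded_linear.pos_bounded[OF bounded_linear_mat] by blast
  have "norm (G z - G w) \<le> p * (cmod (w - z) * K2 * g * K1) * K1"
    if z: "z \<in> sphere 0 1" and w: "w \<in> sphere 0 1" for z w
  proof -
    have zw: "mat z - A = (mat w - A) - mat (w - z)"
      by (simp add: vec_eq_iff mat_def)
    have "(mat z - A) ** G w = B - mat (w - z) ** G w"
      unfolding zw mm.diff_left[of "mat w - A"] resolvent_transfer[OF w] ..
    then have "(mat z - A) ** (G z - G w) = mat (w - z) ** G w"
      by (simp only: mm.diff_right resolvent_transfer[OF z]) simp
    then have "?R z ** ((mat z - A) ** (G z - G w)) = ?R z ** (mat (w - z) ** G w)" by simp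
    then have e: "G z - G w = ?R z ** (mat (w - z) ** G w)"
      by (simp add: matrix_mul_assoc matrix_inv_works[OF invertible_resolvent[OF z]])
    have "norm (mat (w - z) ** G w) \<le> norm (mat (w - z) :: complex^'n^'n) * norm (G w) * K1" by (rule K1)
    also have "\<dots> \<le> (cmod (w - z) * K2) * g * K1"
      using K1(1) K2 g(2)[OF w] g(1) by (intro mult_mono) auto
    finally have 1: "norm (mat (w - z) ** G w) \<le> cmod (w - z) * K2 * g * K1" .
    have "norm (?R z ** (mat (w - z) ** G w)) \<le> norm (?R z) * norm (mat (w - z) ** G w) * K1" by (rule K1)
    also have "\<dots> \<le> p * (cmod (w - z) * K2 * g * K1) * K1"
      using K1(1) K2(1) g(1) p(2)[OF z] p(1) 1 by (intro mult_mono) auto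
    finally show ?thesis unfolding e .
  qed
  then have "norm (G (cis \<theta>) - G (cis \<theta>')) \<le> (p * K2 * g * K1 * K1) * \<bar>\<theta> - \<theta>'\<bar>" for \<theta> \<theta>'
  proof -
    have "norm (G (cis \<theta>) - G (cis \<theta>')) \<le> (p * K2 * g * K1 * K1) * cmod (cis \<theta>' - cis \<theta>)"
      using \<open>\<And>z w. z \<in> sphere 0 1 \<Longrightarrow> w \<in> sphere 0 1 \<Longrightarrow> _\<close>[of "cis \<theta>" "cis \<theta>'"] by (simp add: mult_ac)
    also have "\<dots> \<le> (p * K2 * g * K1 * K1) * \<bar>\<theta>' - \<theta>\<bar>"
      using p g K1 K2 by (intro mult_left_mono cmod_cis_diff_le) auto
    finally show ?thesis by (simp add: abs_minus_commute)
  qed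
  moreover have "0 < p * K2 * g * K1 * K1" using p g K1 K2 by simp
  ultimately show thesis using that by blast
qed

lemma Q_quadratic_form: "u \<bullet> (Q \<Lambda> z *v u) = u \<bullet> u + (G z *v u) \<bullet> (\<Lambda> *v (G z *v u))"
  by (simp add: Q_def matrix_vector_mult_add_rdistrib inner_add_right inner_congruence)

lemma Q_lipschitz:
  assumes r: "0 < r"
  obtains L where "0 < L" "\<And>\<Lambda> u \<theta> \<theta>'. norm \<Lambda> \<le> r \<Longrightarrow> norm u = 1 \<Longrightarrow>
    \<bar>u \<bullet> (Q \<Lambda> (cis \<theta>) *v u) - u \<bullet> (Q \<Lambda> (cis \<theta>') *v u)\<bar> \<le> L * \<bar>\<theta> - \<theta>'\<bar>"
proof -
  obtain l where l: "0 < l" "\<And>\<theta> \<theta>'. norm (G (cis \<theta>) - G (cis \<theta>')) \<le> l * \<bar>\<theta> - \<theta>'\<bar>"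
    using transfer_lipschitz by blast
  obtain g where g: "0 < g" "\<And>z. z \<in> sphere 0 1 \<Longrightarrow> norm (G z) \<le> g"
    using continuous_sphere_bounded[OF continuous_on_transfer] by blast
  obtain K1 where K1: "0 < K1" "\<And>(M::complex^'m^'n) x. norm (M *v x) \<le> K1 * norm M * norm x"
    using matrix_vector_mult_bound by blast
  obtain K2 where K2: "0 < K2" "\<And>(M::complex^'n^'n) x. norm (M *v x) \<le> K2 * norm M * norm x"
    using matrix_vector_mult_bound by blast
  define L where "L = 2 * (K1 * l) * (K2 * r * (K1 * g))"
  have "\<bar>u \<bullet> (Q \<Lambda> (cis \<theta>) *v u) - u \<bullet> (Q \<Lambda> (cis \<theta>') *v u)\<bar> \<le> L * \<bar>\<theta> - \<theta>'\<bar>"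
    if \<Lambda>: "norm \<Lambda> \<le> r" and u: "norm u = 1" for \<Lambda> u \<theta> \<theta>'
  proof -
    define x y where "x = G (cis \<theta>) *v u" and "y = G (cis \<theta>') *v u"
    have b: "norm (G (cis t) *v u) \<le> K1 * g" for t
      using K1(2)[of "G (cis t)" u] g(2)[of "cis t"] K1(1) u
      by (simp add: order_trans[OF _ mult_left_mono])
    have xy: "norm (x - y) \<le> K1 * (l * \<bar>\<theta> - \<theta>'\<bar>)"
      using K1(2)[of "G (cis \<theta>) - G (cis \<theta>')" u] l(2)[of \<theta> \<theta>'] K1(1) u
      by (simp add: x_def y_def matrix_vector_mult_diff_rdistrib order_trans[OF _ mult_left_mono])
    have LL: "norm (\<Lambda> *v v) \<le> K2 * r * norm v" for v
      by (rule order_trans[OF K2(2) mult_right_mono[OF mult_left_mono[OF \<Lambda>]]]) (use K2 in auto)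
    have "\<bar>(x - y) \<bullet> (\<Lambda> *v x)\<bar> \<le> norm (x - y) * norm (\<Lambda> *v x)" by (rule Cauchy_Schwarz_ineq2)
    also have "\<dots> \<le> (K1 * (l * \<bar>\<theta> - \<theta>'\<bar>)) * (K2 * r * (K1 * g))"
    proof (intro mult_mono xy)
      have "K2 * r * norm x \<le> K2 * r * (K1 * g)"
        using b[of \<theta>] K2(1) r by (intro mult_left_mono) (auto simp: x_def)
      then show "norm (\<Lambda> *v x) \<le> K2 * r * (K1 * g)" using LL[of x] by simp
    qed (use K1 l in auto)
    finally have 1: "\<bar>(x - y) \<bullet> (\<Lambda> *v x)\<bar> \<le> (K1 * (l * \<bar>\<theta> - \<theta>'\<bar>)) * (K2 * r * (K1 * g))" .
    have "\<bar>y \<bullet> (\<Lambda> *v (x - y))\<bar> \<le> norm y * norm (\<Lambda> *v (x - y))" by (rule Cauchy_Schwarz_ineq2)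
    also have "\<dots> \<le> (K1 * g) * (K2 * r * (K1 * (l * \<bar>\<theta> - \<theta>'\<bar>)))"
    proof (intro mult_mono)
      show "norm y \<le> K1 * g" using b by (simp add: y_def)
      have "K2 * r * norm (x - y) \<le> K2 * r * (K1 * (l * \<bar>\<theta> - \<theta>'\<bar>))"
        using xy K2(1) r by (intro mult_left_mono) auto
      then show "norm (\<Lambda> *v (x - y)) \<le> K2 * r * (K1 * (l * \<bar>\<theta> - \<theta>'\<bar>))" using LL[of "x - y"] by simp
    qed (use K1 g in auto)
    finally have 2: "\<bar>y \<bullet> (\<Lambda> *v (x - y))\<bar> \<le> (K1 * g) * (K2 * r * (K1 * (l * \<bar>\<theta> - \<theta>'\<bar>)))" .
    have "u \<bullet> (Q \<Lambda> (cis \<theta>) *v u) - u \<bullet> (Q \<Lambda> (cis \<theta>') *v u)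
        = (x - y) \<bullet> (\<Lambda> *v x) + y \<bullet> (\<Lambda> *v (x - y))"
      by (simp add: Q_quadratic_form x_def[symmetric] y_def[symmetric] inner_diff_left inner_diff_right
          matrix_vector_mult_diff_distrib)
    then show ?thesis using 1 2 unfolding L_def by (simp add: algebra_simps)
  qed
  moreover have "0 < L" using K1 K2 l g r by (simp add: L_def)
  ultimately show thesis using that by blast
qed

text \<open>If the form of $Q_\Lambda$ takes a small value $\varepsilon$ at a unit vector \<open>u\<close> and a point of the circle, it stays
  below $\varepsilon + L|\theta-\theta_0|$, and then $\int \mathrm{tr}\,Q_\Lambda^{-1}$ is at least of order
  $\log(1/\varepsilon)$.\<close>

lemma boundary_barrier:
  assumes r: "0 < r"
  obtains \<epsilon> where "0 < \<epsilon>" "\<And>\<Lambda> z u. \<Lambda> \<in> L_H A B \<Longrightarrow> norm \<Lambda> \<le> r \<Longrightarrow>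
    circle_integral (\<lambda>z. Re (trace (matrix_inv (Q \<Lambda> z)))) \<le> T \<Longrightarrow>
    z \<in> sphere 0 1 \<Longrightarrow> norm u = 1 \<Longrightarrow> \<epsilon> \<le> u \<bullet> (Q \<Lambda> z *v u)"
proof -
  obtain L where L: "0 < L" "\<And>\<Lambda> u \<theta> \<theta>'. norm \<Lambda> \<le> r \<Longrightarrow> norm u = 1 \<Longrightarrow>
    \<bar>u \<bullet> (Q \<Lambda> (cis \<theta>) *v u) - u \<bullet> (Q \<Lambda> (cis \<theta>') *v u)\<bar> \<le> L * \<bar>\<theta> - \<theta>'\<bar>"
    using Q_lipschitz[OF r] by metis
  obtain K where K: "0 < K" "\<And>(M::complex^'m^'m) x. norm (M *v x) \<le> K * norm M * norm x"
    using matrix_vector_mult_bound by blast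
  let ?m = "(real CARD('m))\<^sup>2"
  define D where "D = 2 * pi * (K * ?m * T)"
  \<comment> \<open>The bound is what $\ln(1 + L\pi/\varepsilon) \le LD$ gives for $\varepsilon$.\<close>
  have "L * pi / exp (L * D) \<le> u \<bullet> (Q \<Lambda> z *v u)"
    if LH: "\<Lambda> \<in> L_H A B" and nr: "norm \<Lambda> \<le> r"
      and T: "circle_integral (\<lambda>z. Re (trace (matrix_inv (Q \<Lambda> z)))) \<le> T"
      and z: "z \<in> sphere 0 1" and u: "norm u = 1" for \<Lambda> z u
  proof -
    have u0: "u \<noteq> 0" using u by auto
    have Qp: "pos_def (Q \<Lambda> w)" if "w \<in> sphere 0 1" for w using LH that by (simp add: L_H_iff)
    have qpos: "0 < u \<bullet> (Q \<Lambda> w *v u)" if "w \<in> sphere 0 1" for w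
      using Qp[OF that] u0 by (simp add: pos_def_def)
    obtain \<theta>0 where \<theta>0: "\<theta>0 \<in> {-pi..pi}" "z = cis \<theta>0" using sphere_obtain_angle[OF z] .
    define \<epsilon> where "\<epsilon> = u \<bullet> (Q \<Lambda> z *v u)"
    have \<epsilon>: "0 < \<epsilon>" using qpos[OF z] by (simp add: \<epsilon>_def)
    have pw: "1 / (\<epsilon> + L * \<bar>\<theta> - \<theta>0\<bar>) \<le> K * ?m * Re (trace (matrix_inv (Q \<Lambda> (cis \<theta>))))" for \<theta>
    proof -
      let ?q = "u \<bullet> (Q \<Lambda> (cis \<theta>) *v u)" and ?Y = "matrix_inv (Q \<Lambda> (cis \<theta>))"
      have "?q \<le> \<epsilon> + L * \<bar>\<theta> - \<theta>0\<bar>"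
        using abs_le_D1[OF L(2)[OF nr u, of \<theta> \<theta>0]] by (simp add: \<epsilon>_def \<theta>0(2))
      then have "1 / (\<epsilon> + L * \<bar>\<theta> - \<theta>0\<bar>) \<le> 1 / ?q"
        using qpos[of "cis \<theta>"] by (intro divide_left_mono) auto
      also have "\<dots> \<le> u \<bullet> (?Y *v u)" by (rule inverse_quadratic_form_ge[OF Qp u]) simp
      also have "\<dots> \<le> norm u * norm (?Y *v u)" by (rule norm_cauchy_schwarz)
      also have "\<dots> \<le> K * norm ?Y" using K(2)[of ?Y u] u by simp
      also have "\<dots> \<le> K * (?m * Re (trace ?Y))"
      proof (rule mult_left_mono)
        show "norm ?Y \<le> ?m * Re (trace ?Y)"
          using nonneg_def_norm_le[OF pos_def_imp_nonneg_def[OF pos_def_matrix_inv[OF Qp]]] by simp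
      qed (use K in simp)
      finally show ?thesis by (simp add: mult.assoc)
    qed
    have contY: "continuous_on (sphere 0 1) (\<lambda>z. K * ?m * Re (trace (matrix_inv (Q \<Lambda> z))))"
      by (intro continuous_intros continuous_on_inv_Q LH)
    have "ln (1 + L * pi / \<epsilon>) / L \<le> (LINT \<theta>|circ. 1 / (\<epsilon> + L * \<bar>\<theta> - \<theta>0\<bar>))"
      by (rule integral_reciprocal_ge_ln[OF \<epsilon> L(1) \<theta>0(1)])
    also have "\<dots> \<le> (LINT \<theta>|circ. K * ?m * Re (trace (matrix_inv (Q \<Lambda> (cis \<theta>)))))"
    proof (rule integral_mono[OF _ integrable_circ_continuous[OF contY] pw])
      have "continuous_on {-pi..pi} (\<lambda>\<theta>. 1 / (\<epsilon> + L * \<bar>\<theta> - \<theta>0\<bar>))"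
        using \<epsilon> L(1) by (intro continuous_intros ballI) (smt (verit) mult_nonneg_nonneg abs_ge_zero)
      then show "integrable circ (\<lambda>\<theta>. 1 / (\<epsilon> + L * \<bar>\<theta> - \<theta>0\<bar>))"
        by (rule continuous_imp_integrable_real)
    qed
    also have "\<dots> = 2 * pi * circle_integral (\<lambda>z. (K * ?m) *\<^sub>R Re (trace (matrix_inv (Q \<Lambda> z))))"
      by (simp add: circle_integral_def)
    also have "\<dots> \<le> D"
      using circle_integral_scaleR[of "K * ?m" "\<lambda>z. Re (trace (matrix_inv (Q \<Lambda> z)))"]
        mult_left_mono[OF T, of "K * ?m"] K(1) by (simp add: D_def)
    finally have "ln (1 + L * pi / \<epsilon>) \<le> L * D" using L(1) by (simp add: field_simps)
    moreover have pp: "0 < L * pi / \<epsilon>" using \<epsilon> L(1) by simp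
    ultimately have "1 + L * pi / \<epsilon> \<le> exp (L * D)"
      by (metis add_pos_pos exp_le_cancel_iff exp_ln zero_less_one)
    then have "L * pi / \<epsilon> \<le> exp (L * D)" by simp
    then show ?thesis using \<epsilon> by (simp add: \<epsilon>_def[symmetric] field_simps)
  qed
  moreover have "0 < L * pi / exp (L * D)" using L(1) by simp
  ultimately show thesis using that by blast
qed

end

section \<open>Existence and uniqueness of the minimizer\<close>

context feasible_dual_problem
begin

text \<open>Dominated convergence: on a compact subset of the domain the inverses of $Q_\Lambda$ are uniformly
  bounded, by joint continuity in \<open>\<Lambda>\<close> and the point of the circle.\<close>

lemma continuous_on_J:
  assumes K: "compact K" "K \<subseteq> L_H A B"
  shows "continuous_on K J"
proof -
  have cont: "continuous_on (K \<times> sphere 0 1) (\<lambda>p. matrix_inv (Q (fst p) (snd p)))"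
  proof (intro continuous_on_matrix_inv continuous_on_Q continuous_on_fst continuous_on_snd continuous_on_id)
    show "invertible (Q (fst p) (snd p))" if "p \<in> K \<times> sphere 0 1" for p
    proof -
      have "fst p \<in> L_H A B" "snd p \<in> sphere 0 1" using that K(2) by auto
      then show ?thesis by (simp add: L_H_iff pos_def_imp_invertible)
    qed
  qed auto
  obtain p where p: "0 < p" "\<And>x. x \<in> K \<times> sphere 0 1 \<Longrightarrow> norm (matrix_inv (Q (fst x) (snd x))) \<le> p"
    using compact_imp_bounded[OF compact_continuous_image[OF cont compact_Times[OF K(1) compact_sphere]]]
    unfolding bounded_pos by blast
  obtain q where q: "0 < q" "\<And>z. z \<in> sphere 0 1 \<Longrightarrow> norm (\<Psi> z) \<le> q"
    using S_plusD(2)[OF Psi] unfolding bounded_pos by blast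
  obtain k where k: "0 < k" "\<And>(X::complex^'m^'m) Y. \<bar>Re (trace (X ** Y))\<bar> \<le> k * norm X * norm Y"
    using Re_trace_mult_bound by blast
  let ?f = "\<lambda>\<Lambda> z. Re (trace (matrix_inv (Q \<Lambda> z) ** \<Psi> z))"
  have int: "integrable_circle (?f \<Lambda>)" if "\<Lambda> \<in> K" for \<Lambda>
    using integrable_trace(2)[OF S_plusD(1,2)[OF Psi] continuous_on_inv_Q] that K(2) by blast
  have "continuous_on K J_integral"
  proof (rule continuous_on_sequentiallyI)
    fix \<Lambda> :: "nat \<Rightarrow> complex^'n^'n" and \<Lambda>0
    assume \<Lambda>: "\<forall>n. \<Lambda> n \<in> K" and \<Lambda>0: "\<Lambda>0 \<in> K" and lim: "\<Lambda> \<longlonglongrightarrow> \<Lambda>0"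
    have "(\<lambda>n. LINT \<theta>|circ. ?f (\<Lambda> n) (cis \<theta>)) \<longlonglongrightarrow> (LINT \<theta>|circ. ?f \<Lambda>0 (cis \<theta>))"
    proof (rule integral_dominated_convergence)
      show "(\<lambda>\<theta>. ?f \<Lambda>0 (cis \<theta>)) \<in> borel_measurable circ"
        using int[OF \<Lambda>0] by (rule borel_measurable_integrable)
      show "(\<lambda>\<theta>. ?f (\<Lambda> n) (cis \<theta>)) \<in> borel_measurable circ" for n
        using int \<Lambda> by (blast intro: borel_measurable_integrable)
      show "integrable circ (\<lambda>\<theta>. k * p * q)"
        by (rule finite_measure.integrable_const[OF finite_measure_circ])
      show "AE \<theta> in circ. norm (?f (\<Lambda> n) (cis \<theta>)) \<le> k * p * q" for n
      proof (rule AE_I2)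
        fix \<theta>
        have "\<bar>?f (\<Lambda> n) (cis \<theta>)\<bar> \<le> k * norm (matrix_inv (Q (\<Lambda> n) (cis \<theta>))) * norm (\<Psi> (cis \<theta>))"
          by (rule k)
        also have "\<dots> \<le> k * p * q"
          using p(2)[of "(\<Lambda> n, cis \<theta>)"] q(2)[of "cis \<theta>"] \<Lambda> k(1) p(1) by (intro mult_mono) auto
        finally show "norm (?f (\<Lambda> n) (cis \<theta>)) \<le> k * p * q" by simp
      qed
      show "AE \<theta> in circ. (\<lambda>n. ?f (\<Lambda> n) (cis \<theta>)) \<longlonglongrightarrow> ?f \<Lambda>0 (cis \<theta>)"
      proof (rule AE_I2)
        fix \<theta>
        have "continuous_on K (\<lambda>\<Lambda>. matrix_inv (Q (fst (\<Lambda>, cis \<theta>)) (snd (\<Lambda>, cis \<theta>))))"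
          by (rule continuous_on_compose2[OF cont]) (auto intro!: continuous_intros)
        then have "continuous_on K (\<lambda>\<Lambda>. ?f \<Lambda> (cis \<theta>))"
          by (auto intro!: continuous_intros)
        then show "(\<lambda>n. ?f (\<Lambda> n) (cis \<theta>)) \<longlonglongrightarrow> ?f \<Lambda>0 (cis \<theta>)"
          by (rule continuous_on_tendsto_compose[OF _ lim \<Lambda>0]) (use \<Lambda> in simp)
      qed
    qed
    from tendsto_scaleR[OF tendsto_const this]
    show "(\<lambda>n. J_integral (\<Lambda> n)) \<longlonglongrightarrow> J_integral \<Lambda>0"
      unfolding J_integral_def circle_integral_def .
  qed
  then have "continuous_on K (\<lambda>\<Lambda>. J_integral \<Lambda> + Re (trace \<Lambda>))"
    by (intro continuous_intros)
  then show ?thesis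
    by (rule continuous_on_eq) (use K(2) J_eq in auto)
qed

text \<open>The sublevel set of \<open>0\<close> lies in a compact set on which the form of $Q_\Lambda$ is uniformly bounded below.\<close>

lemma J_attains_inf: "\<exists>\<Lambda>\<in>L_Gam A B. \<forall>\<Lambda>'\<in>L_Gam A B. J \<Lambda> \<le> J \<Lambda>'"
proof -
  have zero: "0 \<in> L_Gam A B"
    unfolding L_Gam_iff using subspace_0[OF subspace_V] by (simp add: Q_def mm.zero_left mm.zero_right)
  obtain T where T: "\<forall>\<Lambda>\<in>L_H A B. J \<Lambda> \<le> J 0 \<longrightarrow>
    circle_integral (\<lambda>z. Re (trace (Q \<Lambda> z))) \<le> T \<and>
    circle_integral (\<lambda>z. Re (trace (matrix_inv (Q \<Lambda> z)))) \<le> T"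
    using sublevel_integral_bounds by blast
  obtain r0 where r0: "\<And>\<Lambda>. \<Lambda> \<in> L_Gam A B \<Longrightarrow> circle_integral (\<lambda>z. Re (trace (Q \<Lambda> z))) \<le> T \<Longrightarrow> norm \<Lambda> \<le> r0"
    using bounded_of_integral_bound by blast
  define r where "r = max 1 r0"
  have r: "0 < r" by (simp add: r_def)
  obtain \<epsilon> where \<epsilon>: "0 < \<epsilon>" "\<And>\<Lambda> z u. \<Lambda> \<in> L_H A B \<Longrightarrow> norm \<Lambda> \<le> r \<Longrightarrow>
    circle_integral (\<lambda>z. Re (trace (matrix_inv (Q \<Lambda> z)))) \<le> T \<Longrightarrow>
    z \<in> sphere 0 1 \<Longrightarrow> norm u = 1 \<Longrightarrow> \<epsilon> \<le> u \<bullet> (Q \<Lambda> z *v u)"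
    using boundary_barrier[OF r, of T] by metis
  define K where "K = {\<Lambda>\<in>V. norm \<Lambda> \<le> r \<and> (\<forall>z\<in>sphere 0 1. \<forall>u\<in>sphere 0 1. \<epsilon> \<le> u \<bullet> (Q \<Lambda> z *v u))}"
  have closed: "closed {\<Lambda>. \<epsilon> \<le> u \<bullet> (Q \<Lambda> z *v u)}" for z u
    unfolding Q_def
    by (intro closed_Collect_le continuous_on_inner continuous_on_mv continuous_intros)
  have "K = V \<inter> cball 0 r \<inter> (\<Inter>z\<in>sphere 0 1. \<Inter>u\<in>sphere 0 1. {\<Lambda>. \<epsilon> \<le> u \<bullet> (Q \<Lambda> z *v u)})"
    by (auto simp: K_def)
  also have "compact \<dots>"
    by (intro compact_Int_closed closed_Int_compact closed_subspace subspace_V compact_cball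
        closed_INT ballI closed)
  finally have compact: "compact K" .
  have KL: "K \<subseteq> L_Gam A B"
  proof
    fix \<Lambda> assume \<Lambda>: "\<Lambda> \<in> K"
    have "pos_def (Q \<Lambda> z)" if z: "z \<in> sphere 0 1" for z
      unfolding pos_def_def
    proof (intro conjI allI impI)
      show "herm (Q \<Lambda> z)" using \<Lambda> herm_V herm_Q by (simp add: K_def)
      fix v :: "complex^'m" assume v: "v \<noteq> 0"
      define w where "w = v /\<^sub>R norm v"
      have "norm w = 1" using v by (simp add: w_def)
      then have "0 < w \<bullet> (Q \<Lambda> z *v w)" using \<Lambda> z \<epsilon>(1) by (force simp: K_def)
      then have "0 < (norm v)\<^sup>2 * (w \<bullet> (Q \<Lambda> z *v w))" using v by simp
      also have "\<dots> = (norm v *\<^sub>R w) \<bullet> (Q \<Lambda> z *v (norm v *\<^sub>R w))"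
        by (simp add: matrix_vector_mult_scaleR_complex power2_eq_square)
      finally show "0 < v \<bullet> (Q \<Lambda> z *v v)" using v by (simp add: w_def)
    qed
    then show "\<Lambda> \<in> L_Gam A B" using \<Lambda> by (simp add: L_Gam_iff K_def)
  qed
  have sub: "\<Lambda> \<in> K" if \<Lambda>: "\<Lambda> \<in> L_Gam A B" and J: "J \<Lambda> \<le> J 0" for \<Lambda>
  proof -
    have LH: "\<Lambda> \<in> L_H A B" and V: "\<Lambda> \<in> V" using \<Lambda> by (auto simp: L_Gam_def)
    have b: "circle_integral (\<lambda>z. Re (trace (Q \<Lambda> z))) \<le> T"
      "circle_integral (\<lambda>z. Re (trace (matrix_inv (Q \<Lambda> z)))) \<le> T"
      using T LH J by blast+
    have "norm \<Lambda> \<le> r" using r0[OF \<Lambda> b(1)] by (simp add: r_def)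
    then show ?thesis using V \<epsilon>(2)[OF LH _ b(2)] by (simp add: K_def)
  qed
  have "K \<noteq> {}" using sub[OF zero] by auto
  moreover have "continuous_on K J"
    using KL by (intro continuous_on_J compact) (auto simp: L_Gam_def)
  ultimately obtain \<Lambda> where \<Lambda>: "\<Lambda> \<in> K" "\<forall>\<Lambda>'\<in>K. J \<Lambda> \<le> J \<Lambda>'"
    using continuous_attains_inf[OF compact] by blast
  have "J \<Lambda> \<le> J 0" using \<Lambda>(2) sub[OF zero] by simp
  then have "J \<Lambda> \<le> J \<Lambda>'" if "\<Lambda>' \<in> L_Gam A B" for \<Lambda>'
    using \<Lambda>(2) sub[OF that] by (cases "J \<Lambda>' \<le> J 0") auto
  then show ?thesis using \<Lambda>(1) KL by blast
qed

text \<open>Strict convexity: if both end points minimize, the mean of their values does not exceed the value at the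
  midpoint. By convexity the difference dominates the integral of a non-negative continuous function, which then has to vanish
  identically. Then $G^*(\Lambda_1-\Lambda_2)G = 0$
  on the circle, so $\Lambda_1-\Lambda_2$ is orthogonal to the range of $\Gamma$, to which it belongs.\<close>

lemma minimizer_unique:
  assumes L: "\<Lambda>1 \<in> L_Gam A B" "\<Lambda>2 \<in> L_Gam A B"
    and min: "\<And>\<Lambda>. \<Lambda> \<in> L_Gam A B \<Longrightarrow> J \<Lambda>1 \<le> J \<Lambda>" "\<And>\<Lambda>. \<Lambda> \<in> L_Gam A B \<Longrightarrow> J \<Lambda>2 \<le> J \<Lambda>"
  shows "\<Lambda>1 = \<Lambda>2"
proof -
  have LH: "\<Lambda>1 \<in> L_H A B" "\<Lambda>2 \<in> L_H A B" and inV: "\<Lambda>1 \<in> V" "\<Lambda>2 \<in> V"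
    using L by (auto simp: L_Gam_def)
  define M where "M = (1/2) *\<^sub>R (\<Lambda>1 + \<Lambda>2)"
  define D where "D = (\<lambda>z. (1/2) *\<^sub>R (Q \<Lambda>1 z - Q \<Lambda>2 z))"
  have QM: "Q M z = (1/2) *\<^sub>R (Q \<Lambda>1 z + Q \<Lambda>2 z)" for z
  proof -
    have half: "mat 1 = (1/2) *\<^sub>R (mat 1 + mat 1 :: complex^'m^'m)" by (simp flip: scaleR_2)
    have "Q M z = mat 1 + (1/2) *\<^sub>R (ctrans (G z) ** \<Lambda>1 ** G z + ctrans (G z) ** \<Lambda>2 ** G z)"
      by (simp only: Q_def M_def mm.scaleR_left mm.scaleR_right mm.add_left mm.add_right)
    also have "\<dots> = (1/2) *\<^sub>R (Q \<Lambda>1 z + Q \<Lambda>2 z)"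
      by (subst half) (simp only: Q_def scaleR_add_right ac_simps)
    finally show ?thesis .
  qed
  have Qp: "pos_def (Q \<Lambda>1 z)" "pos_def (Q \<Lambda>2 z)" if "z \<in> sphere 0 1" for z
    using LH that by (simp_all add: L_H_iff)
  obtain c :: real where c: "0 < c" "AE \<theta> in circ. pos_def (\<Psi> (cis \<theta>) - mat (of_real c))"
    using Psi by (auto simp: S_plus_def)
  have n: "AE \<theta> in circ. nonneg_def (\<Psi> (cis \<theta>) - mat (of_real c))"
    by (rule AE_mp[OF c(2)]) (simp add: pos_def_imp_nonneg_def)
  have c0: "0 \<le> c" using c(1) by simp
  have "pos_def (Q M z)" if "z \<in> sphere 0 1" for z
    unfolding QM by (rule pos_def_midpoint[OF Qp[OF that]])
  moreover have "M \<in> V"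
    unfolding M_def by (intro subspace_scale subspace_add subspace_V inV)
  ultimately have MG: "M \<in> L_Gam A B" by (simp add: L_Gam_iff)
  then have MH: "M \<in> L_H A B" by (simp add: L_Gam_def)
  let ?f = "\<lambda>\<Lambda> z. Re (trace (matrix_inv (Q \<Lambda> z) ** \<Psi> z))"
  let ?N = "\<lambda>z. D z ** matrix_inv (Q M z)"
  let ?E = "\<lambda>z. ctrans (?N z) ** matrix_inv (Q \<Lambda>1 z) ** ?N z"
  let ?e = "\<lambda>z. (c / 2) *\<^sub>R Re (trace (?E z))"
  have contE: "continuous_on (sphere 0 1) (\<lambda>z. Re (trace (?E z)))"
    unfolding D_def by (intro continuous_intros continuous_on_Q_circle continuous_on_inv_Q MH LH)
  have conte: "continuous_on (sphere 0 1) ?e" by (intro continuous_intros contE)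
  have nnE: "nonneg_def (?E z)" if "z \<in> sphere 0 1" for z
    by (intro nonneg_def_congruence nonneg_inv_Q LH that)
  have int: "integrable_circle (?f \<Lambda>)" if "\<Lambda> \<in> L_H A B" for \<Lambda>
    by (rule integrable_trace(2)[OF S_plusD(1,2)[OF Psi] continuous_on_inv_Q[OF that]])
  note ints = int[OF MH] int[OF LH(1)] int[OF LH(2)] integrable_circ_continuous[OF conte]
  have le: "circle_integral (\<lambda>z. ?f M z + ?e z) \<le> circle_integral (\<lambda>z. (1/2) *\<^sub>R (?f \<Lambda>1 z + ?f \<Lambda>2 z))"
  proof (rule circle_integral_mono_AE)
    show "integrable_circle (\<lambda>z. ?f M z + ?e z)"
      using ints by (intro Bochner_Integration.integrable_add)
    show "integrable_circle (\<lambda>z. (1/2) *\<^sub>R (?f \<Lambda>1 z + ?f \<Lambda>2 z))"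
      using ints by (intro integrable_scaleR_right Bochner_Integration.integrable_add)
    show "AE \<theta> in circ. ?f M (cis \<theta>) + ?e (cis \<theta>) \<le> (1/2) *\<^sub>R (?f \<Lambda>1 (cis \<theta>) + ?f \<Lambda>2 (cis \<theta>))"
    proof (rule AE_mp[OF n], intro AE_I2 impI)
      fix \<theta> assume "nonneg_def (\<Psi> (cis \<theta>) - mat (of_real c))"
      from trace_inverse_midpoint[OF Qp[OF cis_in_sphere] c0 this]
      show "?f M (cis \<theta>) + ?e (cis \<theta>) \<le> (1/2) *\<^sub>R (?f \<Lambda>1 (cis \<theta>) + ?f \<Lambda>2 (cis \<theta>))"
        by (simp add: QM D_def)
    qed
  qed
  have lhs: "circle_integral (\<lambda>z. ?f M z + ?e z) = J_integral M + circle_integral ?e"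
    unfolding J_integral_def by (rule circle_integral_add[OF ints(1,4)])
  have rhs: "circle_integral (\<lambda>z. (1/2) *\<^sub>R (?f \<Lambda>1 z + ?f \<Lambda>2 z)) = (1/2) * (J_integral \<Lambda>1 + J_integral \<Lambda>2)"
    using circle_integral_scaleR[of "1/2" "\<lambda>z. ?f \<Lambda>1 z + ?f \<Lambda>2 z"]
    unfolding J_integral_def circle_integral_add[OF ints(2,3)] by simp
  define s where "s = circle_integral ?e"
  have "J_integral M + s \<le> (1/2) * (J_integral \<Lambda>1 + J_integral \<Lambda>2)" using le unfolding lhs rhs s_def .
  then have "2 * J_integral M + 2 * s \<le> J_integral \<Lambda>1 + J_integral \<Lambda>2" by (simp add: field_simps)
  moreover have "2 * Re (trace M) = Re (trace \<Lambda>1) + Re (trace \<Lambda>2)"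
  proof -
    have "trace M = (1/2) *\<^sub>R (trace \<Lambda>1 + trace \<Lambda>2)"
      by (simp only: M_def linear_cmul[OF bounded_linear.linear[OF bounded_linear_trace]] trace_add)
    then show ?thesis by (simp only: scaleR_complex.sel plus_complex.sel real_scaleR_def) simp
  qed
  moreover have "J \<Lambda>1 \<le> J M" "J \<Lambda>2 \<le> J M" using min MG by blast+
  ultimately have s0: "s \<le> 0"
    using J_eq[OF LH(1)] J_eq[OF LH(2)] J_eq[OF MH] by linarith
  have e0: "?e z = 0" if z: "z \<in> sphere 0 1" for z
  proof (rule circle_integral_continuous_nonpos[OF conte _ s0[unfolded s_def] z])
    show "0 \<le> ?e w" if "w \<in> sphere 0 1" for w
      using c0 by (intro scaleR_nonneg_nonneg Re_trace_nonneg nnE that) simp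
  qed
  have D0: "Q (\<Lambda>1 - \<Lambda>2) z - mat 1 = 0" if z: "z \<in> sphere 0 1" for z
  proof -
    have "Re (trace (?E z)) = 0" using e0[OF z] c(1) by simp
    then have "?E z = 0" by (rule nonneg_def_trace_eq_0[OF nnE[OF z]])
    then have "?N z = 0" by (rule congruence_eq_0[OF pos_def_matrix_inv[OF Qp(1)[OF z]]])
    then have "?N z ** Q M z = 0" by (simp only: mm.zero_left)
    moreover have "matrix_inv (Q M z) ** Q M z = mat 1"
      using MH z by (intro matrix_inv_works pos_def_imp_invertible) (simp add: L_H_iff)
    ultimately have "D z = 0" by (simp flip: matrix_mul_assoc)
    then show ?thesis by (simp add: D_def Q_def mm.diff_left mm.diff_right)
  qed
  have dV: "\<Lambda>1 - \<Lambda>2 \<in> V" by (intro subspace_diff subspace_V inV)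
  then obtain \<Phi> where \<Phi>: "\<Phi> \<in> C_herm" "\<Lambda>1 - \<Lambda>2 = Gam A B \<Phi>" by blast
  have "(\<Lambda>1 - \<Lambda>2) \<bullet> (\<Lambda>1 - \<Lambda>2) = Re (trace ((\<Lambda>1 - \<Lambda>2) ** Gam A B \<Phi>))"
    using inner_herm_trace[OF herm_V[OF dV]] \<Phi>(2) by simp
  also have "\<dots> = circle_integral (\<lambda>z. Re (trace (\<Phi> z ** (Q (\<Lambda>1 - \<Lambda>2) z - mat 1))))"
    by (rule trace_Gam[OF C_herm_measurable_bounded[OF \<Phi>(1)]])
  also have "\<dots> = circle_integral (\<lambda>z. 0)"
    by (rule circle_integral_cong) (simp only: D0 mm.zero_right, simp add: trace_def)
  finally show ?thesis by simp
qed

lemma ex1_arg_min: "\<exists>!\<Lambda>. is_arg_min J (\<lambda>\<Lambda>. \<Lambda> \<in> L_Gam A B) \<Lambda>"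
proof -
  obtain \<Lambda> where \<Lambda>: "\<Lambda> \<in> L_Gam A B" "\<forall>\<Lambda>'\<in>L_Gam A B. J \<Lambda> \<le> J \<Lambda>'"
    using J_attains_inf by blast
  show ?thesis
  proof (rule ex1I)
    show "is_arg_min J (\<lambda>\<Lambda>. \<Lambda> \<in> L_Gam A B) \<Lambda>"
      using \<Lambda> by (auto simp: is_arg_min_linorder)
    fix \<Lambda>' assume "is_arg_min J (\<lambda>\<Lambda>. \<Lambda> \<in> L_Gam A B) \<Lambda>'"
    then show "\<Lambda>' = \<Lambda>"
      using \<Lambda> by (intro minimizer_unique) (auto simp: is_arg_min_linorder)
  qed
qed

end

theorem theorem7p6:
  fixes A :: "complex^'n^'n"
    and B :: "complex^'m^'n"
    and \<Psi> :: "complex \<Rightarrow> complex^'m^'m"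
  assumes "\<Psi> \<in> S_plus"
    and "\<And>l. eigenvalue A l \<Longrightarrow> l \<in> ball 0 1"
    and "rank B = CARD('m)"
    and "reachable A B"
  shows "(feasible A B \<longleftrightarrow> rank (block_matrix A B) = 2 * CARD('m)) \<and>
    (feasible A B \<longleftrightarrow>
      (mat 1 - Pi_proj B) ** (mat 1 - A ** ctrans A) ** (mat 1 - Pi_proj B) = 0) \<and>
    (feasible A B \<longrightarrow> (\<exists>!\<Lambda>. is_arg_min (J_dual A B \<Psi>) (\<lambda>\<Lambda>. \<Lambda> \<in> L_Gam A B) \<Lambda>))"
proof -
  interpret stable_filter A B
    using assms(2,3) by unfold_locales
  have cond: "feasible A B \<longleftrightarrow> C ** (mat 1 - A ** ctrans A) ** C = 0"
    using feasible_imp_condition condition_imp_feasible by blast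
  have "\<exists>!\<Lambda>. is_arg_min (J_dual A B \<Psi>) (\<lambda>\<Lambda>. \<Lambda> \<in> L_Gam A B) \<Lambda>" if "feasible A B"
  proof -
    interpret feasible_dual_problem A B \<Psi>
      using assms(1) that by unfold_locales
    show ?thesis by (rule ex1_arg_min)
  qed
  then show ?thesis using cond rank_block_matrix_iff by blast
qed

end
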